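(* Assume the following. (1) (Within-cluster variation) $\|\xi_i\|_2\le\varepsilon_c$ for all $i\in[n]$, for a constant $\varepsilon_c\ge 0$. (2) (Outlier rate) $\max_{k\in[K]}\frac{|\mathcal O\cap\Lambda_k|}{n_k}\le\rho$ for a constant $\rho>0$. (3) (Outlier magnitude) $\|o_i\|_2\le\varepsilon_o$ for all $i\in\mathcal O$, for a constant $\varepsilon_o\ge0$, and $\varepsilon_c+\rho\varepsilon_o>0$. (4) (Cluster-center Jacobian) There are constants $\alpha_c,\beta_c,L_c>0$ such that for every $W\in\mathcal D(W_0,R_{\mathrm{loc}})$ and every unit vector $z\in\mathbb R^{Kp}$, $\alpha_c\le\|J_c(W)^\top z\|_2\le\beta_c$, and for all $W_1,W_2\in\mathcal D(W_0,R_{\mathrm{loc}})$, $\|J_c(W_1)-J_c(W_2)\|\le L_c\|W_1-W_2\|_F$. (5) (Radius condition) $R_{\mathrm{loc}}\ge\frac{2\beta}{\alpha^2}\widehat R_0$. (6) (Activation bounds) $\phi$ is twice differentiable with $|\phi'(t)|\le B_1$ and $|\phi''(t)|\le B_2$ for all $t\in\mathbb R$. (7) (Step size) $0<\eta\le\min\left\{\frac{\alpha^2}{8\beta^4},\frac{\alpha^2}{2L\beta^2\widehat R_0}\right\}$. (8) $T\ge T_\star(\varepsilon_c+\rho\varepsilon_o)$ is an integer with $\Delta_{\mathrm{path}}(T)\le R_{\mathrm{loc}}-\frac{2\beta}{\alpha^2}\widehat R_0$ and $\delta:=\min_{a\ne b}\|\mu_a-\mu_b\|_2>2\zeta_T+4(\varepsilon_c+\rho\varepsilon_o)$.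 Then every inlier $i\notin\mathcal O$ satisfies $$\|F_{W_T}(x_i)-x_i\|_2\le\zeta_T+3\varepsilon_c+2\rho\varepsilon_o,$$ and every outlier $i\in\mathcal O$ satisfies $$\|F_{W_T}(x_i)-x_i\|_2\ge\|o_i\|_2-\zeta_T-3\varepsilon_c-2\rho\varepsilon_o.$$ Hence, if an outlier $i\in\mathcal O$ satisfies $\|o_i\|_2>\delta+2\varepsilon_c$, then its reconstruction error is strictly larger than that of every inlier, i.e. $\|F_{W_T}(x_i)-x_i\|_2>\|F_{W_T}(x_j)-x_j\|_2$ for all $j\notin\mathcal O$.
   Context: Data. $n,p,H,K$ are positive integers, $[N]=\{1,\dots,N\}$. Given cluster centers $\mu_1,\dots,\mu_K\in\mathbb R^p$ and a cluster-assignment map $g:[n]\to[K]$, put $\Lambda_k=\{i\in[n]:g(i)=k\}$, $n_k=|\Lambda_k|\ge1$, $n_{\min}=\min_kn_k$, $n_{\max}=\max_kn_k$. The samples are $x_i=\widetilde x_i+\xi_i+o_i\in\mathbb R^p$ with $\widetilde x_i=\mu_{g(i)}$ and $\xi_i,o_i\in\mathbb R^p$. $\mathcal O=\{i\in[n]:o_i\ne0\}$ is the set of outliers; indices not in $\mathcal O$ are inliers. $X=(x_1^\top,\dots,x_n^\top)^\top$ and $\widetilde X=(\widetilde x_1^\top,\dots,\widetilde x_n^\top)^\top$ in $\mathbb R^{np}$. Norms. $\|\cdot\|_2$ is the Euclidean norm. For matrices, $\|\cdot\|$ is the operator norm and $\|\cdot\|_F$ the Frobenius norm. Model. $F_W(x)=A\phi(Wx)$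 for $W\in\mathbb R^{H\times p}$ (trainable), where $A\in\mathbb R^{p\times H}$ is fixed and $\phi:\mathbb R\to\mathbb R$ is applied entrywise. $w=\mathrm{vec}(W)\in\mathbb R^{Hp}$ stacks the columns of $W$; $\mathrm{mat}$ is its inverse. $\mathcal F_W(X)=(F_W(x_1)^\top,\dots,F_W(x_n)^\top)^\top\in\mathbb R^{np}$, similarly $\mathcal F_W(\widetilde X)$ with $\widetilde x_i$ in place of $x_i$, and $\mathcal F_W(\mu)=(F_W(\mu_1)^\top,\dots,F_W(\mu_K)^\top)^\top\in\mathbb R^{Kp}$. $J(W)=\partial\mathcal F_W(X)/\partial w$ and $J_c(W)=\partial\mathcal F_W(\mu)/\partial w\in\mathbb R^{Kp\times Hp}$ are Jacobians with respect to $w$. An initialization $W_0\in\mathbb R^{H\times p}$ and a radius $R_{\mathrm{loc}}>0$ are fixed; $\mathcal D(W_0,R_{\mathrm{loc}})=\{W\in\mathbb R^{H\times p}:\|W-W_0\|_F\le R_{\mathrm{loc}}\}$. Gradient descent. $(W_\tau)_{\tau\ge0}$ starts at $W_0$ and satisfies $w_{\tau+1}=w_\tau-\eta J(W_\tau)^\top r_\tau$, $r_\tau=\mathcal F_{W_\tau}(X)-X$, $W_\tau=\mathrm{mat}(w_\tau)$; this is gradient descent with learning rate $\eta$ on $\frac12\|\mathcal F_W(X)-X\|_2^2$. Constants. $\alpha=\sqrt{n_{\min}}\,\alpha_c$, $\beta=\sqrt{n_{\max}}\,\beta_c$, $L=\sqrt{n_{\max}}\,L_c$; $\widetilde R_0=\|\mathcal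 F_{W_0}(\widetilde X)-\widetilde X\|_2$; $\widehat R_0=\widetilde R_0+\sqrt n\,\varepsilon_c+\sqrt{\rho n}\,\varepsilon_o$; for $\nu>0$, $T_\star(\nu)=\left\lceil\frac{2}{\eta\alpha^2}\log_+\left(\frac{\widehat R_0}{\nu}\right)\right\rceil$ with $\log_+t=\max\{\log t,0\}$; $R_\mu=\max_k\|\mu_k\|_2$; $R_W=\|W_0\|_F+R_{\mathrm{loc}}$; $\Delta_f=\|A\|B_1R_W(\varepsilon_c+\varepsilon_o)$; $\Delta_J=\sqrt n\,\|A\|(B_1+B_2R_WR_\mu)(\varepsilon_c+\varepsilon_o)$; $\beta_X=\beta+\Delta_J$; $\kappa=L\widehat R_0+\beta\beta_X$; $\gamma=\Delta_J\widehat R_0+\beta_X\sqrt n\,\Delta_f$; for integers $T\ge0$, $\Delta_{\mathrm{path}}(T)=\eta\gamma T\exp(\eta\kappa T)$ and $\zeta_T=\Delta_f+\beta\Delta_{\mathrm{path}}(T)$. *)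

theory Defs
  imports "HOL-Analysis.Analysis"
begin

text \<open>Matrices with \<open>a\<close> rows and \<open>b\<close> columns have type \<open>real^'b^'a\<close>. On this type the library
  \<^const>\<open>norm\<close> is the Frobenius norm, not the operator norm.\<close>

lemma norm_matrix_eq_frobenius:
  fixes M :: "real^'b^'a"
  shows "norm M = sqrt (\<Sum>i\<in>UNIV. \<Sum>j\<in>UNIV. (M $ i $ j)\<^sup>2)"
  by (simp add: norm_vec_def L2_set_def sum_nonneg)

definition opnorm :: "real^'b^'a \<Rightarrow> real" where
  "opnorm M = onorm ((*v) M)"

text \<open>Column-stacking of a matrix: the entry in row \<open>h\<close> and column \<open>c\<close> sits at position \<open>(c, h)\<close>,
  the column index being the more significant one.\<close>

definition vec_mat :: "real^'p^'h \<Rightarrow> real^('p \<times> 'h)" where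
  "vec_mat W = (\<chi> q. W $ snd q $ fst q)"

definition unvec_mat :: "real^('p \<times> 'h) \<Rightarrow> real^'p^'h" where
  "unvec_mat w = (\<chi> h c. w $ (c, h))"

lemma unvec_mat_vec_mat: "unvec_mat (vec_mat W) = W"
  by (simp add: vec_mat_def unvec_mat_def vec_eq_iff)

lemma vec_mat_unvec_mat: "vec_mat (unvec_mat w) = w"
  by (simp add: vec_mat_def unvec_mat_def vec_eq_iff)

text \<open>\<open>(v\<^sub>1\<^sup>T, \<dots>, v\<^sub>m\<^sup>T)\<^sup>T\<close> in dimension \<open>m p\<close>.\<close>

definition stack :: "('m::finite \<Rightarrow> real^'p) \<Rightarrow> real^('m \<times> 'p)" where
  "stack v = (\<chi> q. v (fst q) $ snd q)"

definition net :: "real^'h^'p \<Rightarrow> (real \<Rightarrow> real) \<Rightarrow> real^'p^'h \<Rightarrow> real^'p \<Rightarrow> real^'p" where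
  "net A \<phi> W x = A *v (\<chi> h. \<phi> ((W *v x) $ h))"

definition net_stack ::
  "real^'h^'p \<Rightarrow> (real \<Rightarrow> real) \<Rightarrow> ('m::finite \<Rightarrow> real^'p) \<Rightarrow> real^'p^'h \<Rightarrow> real^('m \<times> 'p)" where
  "net_stack A \<phi> v W = stack (\<lambda>i. net A \<phi> W (v i))"

definition net_jacobian ::
  "real^'h^'p \<Rightarrow> (real \<Rightarrow> real) \<Rightarrow> ('m::finite \<Rightarrow> real^'p) \<Rightarrow> real^'p^'h
    \<Rightarrow> real^('p \<times> 'h)^('m \<times> 'p)" where
  "net_jacobian A \<phi> v W = jacobian (\<lambda>w. net_stack A \<phi> v (unvec_mat w)) (at (vec_mat W))"

definition log_plus :: "real \<Rightarrow> real" where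
  "log_plus t = max (ln t) 0"

text \<open>The minimum is taken in the extended reals, so that it is \<open>\<infinity>\<close> when there is only one
  center and hence no pair to minimise over.\<close>

definition center_separation :: "('k::finite \<Rightarrow> real^'p) \<Rightarrow> ereal" where
  "center_separation \<mu> = (INF (a, b) \<in> {(a, b). a \<noteq> b}. ereal (norm (\<mu> a - \<mu> b)))"

end

theory Submission
  imports Defs
begin

text \<open>Compare the actual iterates with those of gradient descent for the model evaluated at the
  cluster centers but with the noisy targets. The Jacobian of that reference problem maps into the
  vectors that are constant on clusters, so only the cluster means of the targets matter, and on this
  subspace it is bounded above by \<open>\<beta>\<close> and, transposed, below by \<open>\<alpha>\<close>. Hence the reference
  iterates stay within \<open>2 \<beta> / \<alpha>\<^sup>2\<close> times the initial residual of the initialization and fit the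
  cluster means up to \<open>\<epsilon>\<^sub>c + \<rho> \<epsilon>\<^sub>o\<close> after \<open>T\<close> steps; the means themselves are that close to
  the centers. Replacing clean by noisy inputs perturbs each step by at most
  \<open>\<eta> (\<kappa> d + \<gamma>)\<close>, where \<open>d\<close> is the current distance of the two paths, and a discrete
  Gronwall estimate bounds that distance by \<open>\<Delta>_path\<close>. So the network sends every sample close to
  its center, and its reconstruction error is essentially the norm of its outlier part.\<close>

section \<open>Gradient descent with a Lipschitz Jacobian\<close>

text \<open>A discrete Gronwall estimate: \<open>1 + a \<le> exp a\<close> absorbs the growth
  factor, and \<open>exp (a * real (Suc t)) \<ge> 1\<close> lets each fresh \<open>b\<close> be
  charged at the common rate.\<close>

lemma exp_growth_recursion:
  fixes d :: "nat \<Rightarrow> real"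
  assumes "d 0 \<le> 0" and "\<And>t. t < T \<Longrightarrow> d (Suc t) \<le> (1 + a) * d t + b" and "a \<ge> 0" "b \<ge> 0"
    and "t \<le> T"
  shows "d t \<le> b * real t * exp (a * real t)"
  using \<open>t \<le> T\<close>
proof (induction t)
  case 0
  then show ?case using assms(1) by simp
next
  case (Suc t)
  have e: "exp (a * real (Suc t)) = exp a * exp (a * real t)"
    by (simp add: algebra_simps exp_add)
  have "d (Suc t) \<le> (1 + a) * d t + b"
    using assms(2) Suc by simp
  also have "\<dots> \<le> (1 + a) * (b * real t * exp (a * real t)) + b"
    using Suc assms by (intro add_right_mono mult_left_mono) auto
  also have "\<dots> \<le> exp a * (b * real t * exp (a * real t)) + b"
    using exp_ge_add_one_self[of a] assms by (intro add_right_mono mult_right_mono) auto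
  also have "\<dots> \<le> exp a * (b * real t * exp (a * real t)) + b * exp (a * real (Suc t))"
    using mult_left_mono[of 1 "exp (a * real (Suc t))" b] assms(3,4) by simp
  also have "\<dots> = b * real (Suc t) * exp (a * real (Suc t))"
    unfolding e by (simp add: algebra_simps del: exp_add)
  finally show ?case .
qed

text \<open>Testing \<open>f\<close> at \<open>adjoint f z\<close> gives the square of
  \<open>norm (adjoint f z)\<close> as \<open>f (adjoint f z) \<bullet> z\<close>; Cauchy-Schwarz
  and one cancellation finish.\<close>

lemma adjoint_norm_bound:
  fixes f :: "'a::euclidean_space \<Rightarrow> 'b::euclidean_space"
  assumes "linear f" and "\<And>v. norm (f v) \<le> c * norm v"
  shows "norm (adjoint f z) \<le> c * norm z"
proof (cases "adjoint f z = 0")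
  case True
  \<comment> \<open>The sign of \<open>c\<close> comes from evaluating at a basis vector, which has
    norm 1.\<close>
  have "0 \<le> c"
  proof -
    obtain b :: 'a where "b \<in> Basis" using nonempty_Basis by blast
    then have "norm (f b) \<le> c" using assms(2)[of b] by simp
    then show ?thesis using norm_ge_zero[of "f b"] by linarith
  qed
  then show ?thesis using True by simp
next
  case False
  have "norm (adjoint f z) * norm (adjoint f z) = f (adjoint f z) \<bullet> z"
    using adjoint_works[OF assms(1), of "adjoint f z" z] by (simp add: power2_norm_eq_inner[symmetric] power2_eq_square)
  also have "\<dots> \<le> norm (f (adjoint f z)) * norm z"
    by (rule norm_cauchy_schwarz)
  also have "\<dots> \<le> (c * norm (adjoint f z)) * norm z"
    using assms(2) by (intro mult_right_mono) auto
  finally have "norm (adjoint f z) * norm (adjoint f z) \<le> (c * norm z) * norm (adjoint f z)"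
    by (simp add: algebra_simps)
  then show ?thesis using False by (simp add: mult_le_cancel_right)
qed

lemma step_size_mult_le:
  fixes \<alpha> \<beta> \<eta> :: real
  assumes "0 < \<alpha>" "\<alpha> \<le> \<beta>" "0 < \<eta>" "\<eta> \<le> \<alpha>\<^sup>2 / (8 * \<beta> ^ 4)"
  shows "\<eta> * \<beta>\<^sup>2 \<le> 1 / 8" "\<eta> * \<alpha>\<^sup>2 \<le> 1 / 8"
proof -
  have \<beta>: "\<beta> > 0" using assms by simp
  have a2: "\<alpha>\<^sup>2 \<le> \<beta>\<^sup>2" using assms by (intro power_mono) auto
  have "\<eta> * (8 * \<beta> ^ 4) \<le> \<alpha>\<^sup>2" using assms(4) \<beta> by (simp add: pos_le_divide_eq)
  then have "\<eta> * \<beta>\<^sup>2 * (8 * \<beta>\<^sup>2) \<le> 1 * \<beta>\<^sup>2" using a2 by (simp add: power2_eq_square power4_eq_xxxx mult_ac)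
  then show eb: "\<eta> * \<beta>\<^sup>2 \<le> 1 / 8" using \<beta> by simp
  have "\<eta> * \<alpha>\<^sup>2 \<le> \<eta> * \<beta>\<^sup>2" using a2 assms by (intro mult_left_mono) auto
  then show "\<eta> * \<alpha>\<^sup>2 \<le> 1 / 8" using eb by linarith
qed

text \<open>A nonpositive \<open>r\<close> makes the upper bound on \<open>\<eta>\<close>
  nonpositive, also for \<open>r = 0\<close>, where the quotient is 0 by convention. The main proof
  gets the positivity of \<open>Rhat\<^sub>0\<close> this way.\<close>

lemma step_size_radius_pos:
  fixes \<eta> :: real
  assumes "0 < \<eta>" "\<eta> \<le> \<alpha>\<^sup>2 / (2 * L * \<beta>\<^sup>2 * r)" "0 < L"
  shows "0 < r"
proof (rule ccontr)
  assume "\<not> 0 < r"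
  then have "\<alpha>\<^sup>2 / (2 * L * \<beta>\<^sup>2 * r) \<le> 0"
    using assms(3) by (intro divide_nonneg_nonpos mult_nonneg_nonpos) auto
  then show False using assms by linarith
qed

text \<open>Derivatives are linear maps with pointwise bounds, so that the parameter space can be
  the matrices themselves under the Frobenius norm. The intended \<open>G\<close> is the network
  stacked over all clean inputs.\<close>

locale lipschitz_jacobian =
  fixes G :: "'a::euclidean_space \<Rightarrow> 'b::euclidean_space" and G' :: "'a \<Rightarrow> 'a \<Rightarrow> 'b"
    and w0 :: 'a and R \<beta> L :: real
  assumes deriv: "\<And>w. w \<in> cball w0 R \<Longrightarrow> (G has_derivative G' w) (at w)"
    and bound: "\<And>w v. w \<in> cball w0 R \<Longrightarrow> norm (G' w v) \<le> \<beta> * norm v"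
    and lipschitz: "\<And>w w' v. w \<in> cball w0 R \<Longrightarrow> w' \<in> cball w0 R \<Longrightarrow>
        norm (G' w v - G' w' v) \<le> L * norm (w - w') * norm v"
begin

lemma linear_deriv: "w \<in> cball w0 R \<Longrightarrow> linear (G' w)"
  using deriv has_derivative_linear by blast

lemma adjoint_bound: "w \<in> cball w0 R \<Longrightarrow> norm (adjoint (G' w) z) \<le> \<beta> * norm z"
  by (rule adjoint_norm_bound[OF linear_deriv bound])

lemma lipschitz_map:
  assumes "w \<in> cball w0 R" "w' \<in> cball w0 R"
  shows "norm (G w - G w') \<le> \<beta> * norm (w - w')"
proof (rule differentiable_bound[of "cball w0 R" G G'])
  show "\<And>x. x \<in> cball w0 R \<Longrightarrow> (G has_derivative G' x) (at x within cball w0 R)"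
    using deriv has_derivative_at_withinI by blast
  show "\<And>x. x \<in> cball w0 R \<Longrightarrow> onorm (G' x) \<le> \<beta>"
    by (rule onorm_le[OF bound])
qed (use assms in auto)

text \<open>Subtracting the linear term along the segment leaves a curve whose speed at time
  \<open>t\<close> is at most \<open>L * (norm d)\<^sup>2 * t\<close>; integration over the unit
  interval gives the factor one half.\<close>

lemma taylor:
  assumes "w \<in> cball w0 R" "w + d \<in> cball w0 R"
  shows "norm (G (w + d) - G w - G' w d) \<le> L / 2 * (norm d)\<^sup>2"
proof -
  have seg: "w + t *\<^sub>R d \<in> cball w0 R" if "0 \<le> t" "t \<le> 1" for t
  proof -
    have "(1 - t) *\<^sub>R w + t *\<^sub>R (w + d) \<in> cball w0 R"
      using that by (intro convexD[OF convex_cball] assms) auto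
    then show ?thesis by (simp add: algebra_simps)
  qed
  define f where "f t = G (w + t *\<^sub>R d) - t *\<^sub>R G' w d" for t :: real
  have fd: "(f has_vector_derivative (G' (w + t *\<^sub>R d) d - G' w d)) (at t)" if "0 \<le> t" "t \<le> 1" for t
  proof -
    have "((\<lambda>t. w + t *\<^sub>R d) has_derivative (\<lambda>h. h *\<^sub>R d)) (at t)"
      by (auto intro!: derivative_eq_intros)
    then have "((\<lambda>t. G (w + t *\<^sub>R d)) has_derivative (\<lambda>h. G' (w + t *\<^sub>R d) (h *\<^sub>R d))) (at t)"
      by (rule has_derivative_compose[where g = G]) (rule deriv[OF seg[OF that]])
    then have "((\<lambda>t. G (w + t *\<^sub>R d)) has_vector_derivative G' (w + t *\<^sub>R d) d) (at t)"
      by (simp add: has_vector_derivative_def linear_scale[OF linear_deriv[OF seg[OF that]]])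
    then show ?thesis
      unfolding f_def by (auto intro!: derivative_eq_intros)
  qed
  have "norm (f 1 - f 0) \<le> (L * (norm d)\<^sup>2 / 2) * 1\<^sup>2 - (L * (norm d)\<^sup>2 / 2) * 0\<^sup>2"
  proof (rule differentiable_bound_general[where f' = "\<lambda>t. G' (w + t *\<^sub>R d) d - G' w d"
        and \<phi> = "\<lambda>t. (L * (norm d)\<^sup>2 / 2) * t\<^sup>2" and \<phi>' = "\<lambda>t. L * (norm d)\<^sup>2 * t"])
    show "continuous_on {0..1} f"
      using fd has_vector_derivative_continuous
      by (intro continuous_at_imp_continuous_on) force
    show "(f has_vector_derivative G' (w + t *\<^sub>R d) d - G' w d) (at t)" if "0 < t" "t < 1" for t
      using fd that by simp
    show "((\<lambda>t. L * (norm d)\<^sup>2 / 2 * t\<^sup>2) has_vector_derivative L * (norm d)\<^sup>2 * t) (at t)" for t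
      by (auto intro!: derivative_eq_intros simp: has_real_derivative_iff_has_vector_derivative[symmetric])
    show "norm (G' (w + t *\<^sub>R d) d - G' w d) \<le> L * (norm d)\<^sup>2 * t" if "0 < t" "t < 1" for t
      using lipschitz[OF seg assms(1), of t d] that by (simp add: power2_eq_square mult_ac)
  qed (auto intro!: continuous_intros)
  then show ?thesis by (simp add: f_def algebra_simps)
qed

text \<open>The linearized step shrinks the residual by the factor
  \<open>1 - 15 / 16 * (\<eta> * \<alpha>\<^sup>2)\<close>, because the residual lies in
  \<open>S\<close>, where the adjoint is bounded below. The Taylor remainder gives back at most
  \<open>\<eta> * \<alpha>\<^sup>2 / 4\<close> of it, by the step size bound that involves
  \<open>L\<close>. The balance \<open>11 / 16\<close> is rounded down to one half.\<close>

lemma residual_contraction: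
  assumes S: "subspace S" "\<And>v. G' w v \<in> S"
    and w: "w \<in> cball w0 R"
    and lower: "\<And>z. z \<in> S \<Longrightarrow> \<alpha> * norm z \<le> norm (adjoint (G' w) z)"
    and \<alpha>: "0 < \<alpha>" "\<alpha> \<le> \<beta>" and L: "0 < L" and \<eta>: "0 < \<eta>" "\<eta> \<le> \<alpha>\<^sup>2 / (8 * \<beta> ^ 4)"
      "\<eta> \<le> \<alpha>\<^sup>2 / (2 * L * \<beta>\<^sup>2 * r)"
    and s: "G w - y \<in> S" "norm (G w - y) \<le> r"
    and w': "w' = w - \<eta> *\<^sub>R adjoint (G' w) (G w - y)" "w' \<in> cball w0 R"
  shows "norm (G w' - y) \<le> (1 - \<eta> * \<alpha>\<^sup>2 / 2) * norm (G w - y)"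
proof -
  define s where "s = G w - y"
  define v where "v = adjoint (G' w) s"
  have \<beta>: "\<beta> > 0" using \<alpha> by simp
  have r: "r > 0" by (rule step_size_radius_pos[OF \<eta>(1,3) L])
  have lin: "linear (G' w)" by (rule linear_deriv[OF w])
  have vs: "G' w v \<bullet> s = (norm v)\<^sup>2"
    using adjoint_works[OF lin, of v s] by (simp add: v_def power2_norm_eq_inner)
  note eb = step_size_mult_le(1)[OF \<alpha> \<eta>(1,2)] and ea = step_size_mult_le(2)[OF \<alpha> \<eta>(1,2)]
  have lo: "\<alpha>\<^sup>2 * (norm s)\<^sup>2 \<le> (norm v)\<^sup>2"
    using power_mono[OF lower[OF s(1)], of 2] \<alpha> unfolding v_def s_def by (simp add: power_mult_distrib)
  have up: "norm v \<le> \<beta> * norm s" unfolding v_def by (rule adjoint_bound[OF w])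
  have "(norm (s - \<eta> *\<^sub>R G' w v))\<^sup>2 = (norm s)\<^sup>2 - 2 * \<eta> * (norm v)\<^sup>2 + \<eta>\<^sup>2 * (norm (G' w v))\<^sup>2"
    using vs unfolding power2_norm_eq_inner
    by (simp add: inner_diff inner_commute algebra_simps power2_eq_square)
  also have "\<dots> \<le> (norm s)\<^sup>2 - 2 * \<eta> * (norm v)\<^sup>2 + \<eta>\<^sup>2 * (\<beta>\<^sup>2 * (norm v)\<^sup>2)"
    using power_mono[OF bound[OF w, of v], of 2] by (intro add_left_mono mult_left_mono) (auto simp: power_mult_distrib)
  also have "\<dots> = (norm s)\<^sup>2 - \<eta> * (2 - \<eta> * \<beta>\<^sup>2) * (norm v)\<^sup>2"
    by (simp add: algebra_simps power2_eq_square)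
  \<comment> \<open>\<open>\<eta> * \<beta>\<^sup>2 \<le> 1 / 8\<close> makes
    \<open>2 - \<eta> * \<beta>\<^sup>2\<close> at least \<open>15 / 8\<close>.\<close>
  also have "\<dots> \<le> (norm s)\<^sup>2 - \<eta> * (15 / 8) * (\<alpha>\<^sup>2 * (norm s)\<^sup>2)"
    using eb \<eta>(1) lo by (intro diff_left_mono mult_mono) auto
  \<comment> \<open>Completing the square halves \<open>15 / 8\<close>; the added square is
    nonnegative.\<close>
  also have "\<dots> \<le> ((1 - 15 / 16 * (\<eta> * \<alpha>\<^sup>2)) * norm s)\<^sup>2"
  proof -
    have "((1 - 15 / 16 * (\<eta> * \<alpha>\<^sup>2)) * norm s)\<^sup>2 =
      (norm s)\<^sup>2 - \<eta> * (15 / 8) * (\<alpha>\<^sup>2 * (norm s)\<^sup>2) + (15 / 16 * (\<eta> * \<alpha>\<^sup>2) * norm s)\<^sup>2"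
      by (simp add: power2_eq_square algebra_simps)
    then show ?thesis by simp
  qed
  finally have main: "norm (s - \<eta> *\<^sub>R G' w v) \<le> (1 - 15 / 16 * (\<eta> * \<alpha>\<^sup>2)) * norm s"
    using ea by (intro power2_le_imp_le[OF _ mult_nonneg_nonneg]) auto
  have w'': "w' = w + (- \<eta> *\<^sub>R v)" using w' by (simp add: v_def s_def)
  have "norm (G w' - G w - G' w (- \<eta> *\<^sub>R v)) \<le> L / 2 * (norm (- \<eta> *\<^sub>R v))\<^sup>2"
    using taylor[OF w] w'(2) unfolding w'' by blast
  also have "\<dots> = L / 2 * \<eta>\<^sup>2 * (norm v)\<^sup>2" by (simp add: power_mult_distrib)
  also have "\<dots> \<le> L / 2 * \<eta>\<^sup>2 * (\<beta> * norm s)\<^sup>2"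
    using up L by (intro mult_left_mono power_mono) auto
  also have "\<dots> = \<eta> * (\<eta> * (L / 2 * \<beta>\<^sup>2 * norm s)) * norm s"
    by (simp add: power2_eq_square algebra_simps)
  also have "\<dots> \<le> \<eta> * (\<alpha>\<^sup>2 / 4) * norm s"
  proof (intro mult_right_mono mult_left_mono)
    have "\<eta> * (L / 2 * \<beta>\<^sup>2 * norm s) \<le> \<eta> * (L / 2 * \<beta>\<^sup>2 * r)"
      using s(2) L \<eta>(1) unfolding s_def by (intro mult_left_mono) auto
    also have "\<dots> \<le> \<alpha>\<^sup>2 / 4" using \<eta>(3) L \<beta> r by (simp add: field_simps)
    finally show "\<eta> * (L / 2 * \<beta>\<^sup>2 * norm s) \<le> \<alpha>\<^sup>2 / 4" .
  qed (use \<eta> in auto)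
  finally have rem: "norm (G w' - G w - G' w (- \<eta> *\<^sub>R v)) \<le> \<eta> * (\<alpha>\<^sup>2 / 4) * norm s" .
  have eq: "G w' - y = (s - \<eta> *\<^sub>R G' w v) + (G w' - G w - G' w (- \<eta> *\<^sub>R v))"
    by (simp add: s_def linear_scale[OF lin] linear_neg[OF lin])
  have "norm (G w' - y) \<le> (1 - 15 / 16 * (\<eta> * \<alpha>\<^sup>2)) * norm s + \<eta> * (\<alpha>\<^sup>2 / 4) * norm s"
    unfolding eq by (rule norm_triangle_mono[OF main rem])
  also have "\<dots> = (1 - \<eta> * \<alpha>\<^sup>2 * (11 / 16)) * norm s" by (simp add: algebra_simps)
  also have "\<dots> \<le> (1 - \<eta> * \<alpha>\<^sup>2 / 2) * norm s"
    using \<eta>(1) by (intro mult_right_mono) auto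
  finally show ?thesis by (simp add: s_def)
qed

text \<open>Since \<open>y' - y\<close> is orthogonal to \<open>S\<close>, the targets
  \<open>y'\<close> and \<open>y\<close> give the same gradient, but it is the residual against
  \<open>y\<close> that lies in \<open>S\<close> and contracts. Its geometric decay makes the step
  lengths summable, which keeps the path inside the radius.\<close>

lemma gradient_descent_convergence:
  assumes S: "subspace S" "\<And>w v. w \<in> cball w0 R \<Longrightarrow> G' w v \<in> S"
    and lower: "\<And>w z. w \<in> cball w0 R \<Longrightarrow> z \<in> S \<Longrightarrow> \<alpha> * norm z \<le> norm (adjoint (G' w) z)"
    and \<alpha>: "0 < \<alpha>" "\<alpha> \<le> \<beta>" and L: "0 < L" and \<eta>: "0 < \<eta>" "\<eta> \<le> \<alpha>\<^sup>2 / (8 * \<beta> ^ 4)"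
      "\<eta> \<le> \<alpha>\<^sup>2 / (2 * L * \<beta>\<^sup>2 * r)"
    and GS: "\<And>w. w \<in> cball w0 R \<Longrightarrow> G w - y \<in> S" and r: "norm (G w0 - y) \<le> r"
    and y': "\<And>z. z \<in> S \<Longrightarrow> z \<bullet> (y' - y) = 0"
    and radius: "2 * \<beta> / \<alpha>\<^sup>2 * r \<le> R"
    and u: "u 0 = w0" "\<And>t. u (Suc t) = u t - \<eta> *\<^sub>R adjoint (G' (u t)) (G (u t) - y')"
  shows "norm (u t - w0) \<le> 2 * \<beta> / \<alpha>\<^sup>2 * r" and "u t \<in> cball w0 R"
    and "norm (G (u t) - y) \<le> (1 - \<eta> * \<alpha>\<^sup>2 / 2) ^ t * norm (G w0 - y)"
proof -
  define q where "q = 1 - \<eta> * \<alpha>\<^sup>2 / 2"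
  have \<beta>: "\<beta> > 0" using \<alpha> by simp
  have r0: "r \<ge> 0" using r norm_ge_zero order_trans by blast
  have q: "0 \<le> q" "q \<le> 1"
    using step_size_mult_le(2)[OF \<alpha> \<eta>(1,2)] \<eta>(1) by (auto simp: q_def)
  have grad: "adjoint (G' w) (G w - y') = adjoint (G' w) (G w - y)" if "w \<in> cball w0 R" for w
  proof -
    have lin: "linear (G' w)" by (rule linear_deriv[OF that])
    have "adjoint (G' w) (y' - y) = 0"
    proof (rule vector_eq_ldot[THEN iffD1, rule_format])
      fix v
      show "v \<bullet> adjoint (G' w) (y' - y) = v \<bullet> 0"
        by (simp add: adjoint_works[OF lin] y'[OF S(2)[OF that]])
    qed
    moreover have "G w - y = (G w - y') + (y' - y)" by simp
    ultimately show ?thesis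
      using linear_add[OF adjoint_linear[OF lin]] by (metis add.right_neutral)
  qed
  have ball: "w \<in> cball w0 R" if "norm (w - w0) \<le> 2 * \<beta> / \<alpha>\<^sup>2 * r * (1 - q ^ t)" for w t
  proof -
    have "2 * \<beta> / \<alpha>\<^sup>2 * r * (1 - q ^ t) \<le> 2 * \<beta> / \<alpha>\<^sup>2 * r * 1"
      using \<beta> r0 q by (intro mult_left_mono) auto
    then show ?thesis using that radius by (simp add: dist_norm norm_minus_commute)
  qed
  \<comment> \<open>One induction carries both claims: the contraction needs the next iterate in the
    ball, and the length of the step needs the decay of the residual.\<close>
  have main: "norm (u t - w0) \<le> 2 * \<beta> / \<alpha>\<^sup>2 * r * (1 - q ^ t) \<and>
      norm (G (u t) - y) \<le> q ^ t * norm (G w0 - y)" for t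
  proof (induction t)
    case 0
    then show ?case by (simp add: u)
  next
    case (Suc t)
    then have ut: "u t \<in> cball w0 R" using ball by blast
    have u': "u (Suc t) = u t - \<eta> *\<^sub>R adjoint (G' (u t)) (G (u t) - y)"
      by (simp add: u grad[OF ut])
    have qr: "q ^ t * norm (G w0 - y) \<le> q ^ t * r" using q r by (intro mult_left_mono) auto
    have "norm (u (Suc t) - u t) = \<eta> * norm (adjoint (G' (u t)) (G (u t) - y))"
      using \<eta> by (simp add: u')
    also have "\<dots> \<le> \<eta> * (\<beta> * (q ^ t * r))"
      using adjoint_bound[OF ut, of "G (u t) - y"] Suc qr \<eta> \<beta>
      by (intro mult_left_mono order_trans[OF adjoint_bound[OF ut]]) auto
    also have "\<dots> = 2 * \<beta> / \<alpha>\<^sup>2 * r * (q ^ t * (\<eta> * \<alpha>\<^sup>2 / 2))"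
      using \<alpha> by (simp add: field_simps)
    \<comment> \<open>\<open>\<eta> * \<alpha>\<^sup>2 / 2\<close> is \<open>1 - q\<close>, so the
      bounds on the step lengths telescope.\<close>
    also have "\<dots> = 2 * \<beta> / \<alpha>\<^sup>2 * r * (q ^ t - q ^ Suc t)"
      by (simp add: q_def algebra_simps)
    finally have step: "norm (u (Suc t) - u t) \<le> 2 * \<beta> / \<alpha>\<^sup>2 * r * (q ^ t - q ^ Suc t)" .
    have "norm (u (Suc t) - w0) \<le> norm (u (Suc t) - u t) + norm (u t - w0)"
      by norm
    also have "\<dots> \<le> 2 * \<beta> / \<alpha>\<^sup>2 * r * (q ^ t - q ^ Suc t) + 2 * \<beta> / \<alpha>\<^sup>2 * r * (1 - q ^ t)"
      using step Suc by (intro add_mono) auto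
    also have "\<dots> = 2 * \<beta> / \<alpha>\<^sup>2 * r * (1 - q ^ Suc t)" by (subst distrib_left[symmetric]) simp
    finally have dist: "norm (u (Suc t) - w0) \<le> 2 * \<beta> / \<alpha>\<^sup>2 * r * (1 - q ^ Suc t)" .
    have sr: "norm (G (u t) - y) \<le> r"
    proof -
      have "q ^ t * r \<le> 1 * r" using q r0 by (intro mult_right_mono power_le_one) auto
      then show ?thesis using Suc qr by linarith
    qed
    have "norm (G (u (Suc t)) - y) \<le> q * norm (G (u t) - y)"
      unfolding q_def
      by (rule residual_contraction[OF S(1) S(2)[OF ut] ut lower[OF ut] \<alpha> L \<eta> GS[OF ut] sr u' ball[OF dist]])
    also have "\<dots> \<le> q * (q ^ t * norm (G w0 - y))"
      using q Suc by (intro mult_left_mono) auto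
    finally show ?case using dist by (simp add: mult_ac)
  qed
  show "u t \<in> cball w0 R" using main ball by blast
  show "norm (G (u t) - y) \<le> (1 - \<eta> * \<alpha>\<^sup>2 / 2) ^ t * norm (G w0 - y)"
    using main unfolding q_def by blast
  have "2 * \<beta> / \<alpha>\<^sup>2 * r * (1 - q ^ t) \<le> 2 * \<beta> / \<alpha>\<^sup>2 * r * 1"
    using \<beta> r0 q by (intro mult_left_mono) auto
  then show "norm (u t - w0) \<le> 2 * \<beta> / \<alpha>\<^sup>2 * r"
    using main[of t] by simp
qed

text \<open>The difference of the two gradients is split so that the only residual to be bounded is
  the one along the reference path \<open>u\<close>. The perturbed adjoint acts on the difference of
  the residuals; the perturbation of the derivative, and the change of \<open>G'\<close> between
  \<open>u t\<close> and \<open>w t\<close>, act on the reference residual. The three bounds add up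
  to \<open>\<kappa> * d + \<gamma>\<close> at distance \<open>d\<close>.\<close>

lemma perturbed_gradient_descent:
  assumes lin: "\<And>w. linear (H' w)"
    and H: "\<And>w. w \<in> cball w0 R \<Longrightarrow> norm (H w - G w) \<le> e"
    and H': "\<And>w v. w \<in> cball w0 R \<Longrightarrow> norm (H' w v - G' w v) \<le> e' * norm v"
    and nonneg: "0 \<le> \<beta>" "0 \<le> L" "0 \<le> e" "0 \<le> e'" "0 \<le> r" "0 \<le> \<eta>"
    and u: "u 0 = w0" "\<And>t. u (Suc t) = u t - \<eta> *\<^sub>R adjoint (G' (u t)) (G (u t) - y)"
    and w: "w 0 = w0" "\<And>t. w (Suc t) = w t - \<eta> *\<^sub>R adjoint (H' (w t)) (H (w t) - y)"
    and uR: "\<And>t. u t \<in> cball w0 R" "\<And>t. norm (u t - w0) \<le> R'"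
    and res: "\<And>t. norm (G (u t) - y) \<le> r"
    and \<kappa>: "\<kappa> = L * r + \<beta> * (\<beta> + e')" and \<gamma>: "\<gamma> = e' * r + (\<beta> + e') * e"
    and path: "\<eta> * \<gamma> * real T * exp (\<eta> * \<kappa> * real T) \<le> R - R'"
    and t: "t \<le> T"
  shows "norm (w t - u t) \<le> \<eta> * \<gamma> * real T * exp (\<eta> * \<kappa> * real T) \<and> w t \<in> cball w0 R"
proof -
  have \<kappa>0: "\<kappa> \<ge> 0" and \<gamma>0: "\<gamma> \<ge> 0" using nonneg by (auto simp: \<kappa> \<gamma>)
  have mono: "\<eta> * \<gamma> * real t * exp (\<eta> * \<kappa> * real t) \<le> \<eta> * \<gamma> * real T * exp (\<eta> * \<kappa> * real T)"
    if "t \<le> T" for t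
    using that \<kappa>0 \<gamma>0 nonneg by (intro mult_mono mult_left_mono) (auto intro!: mult_left_mono)
  \<comment> \<open>The reference path takes up \<open>R'\<close> of the radius; by
    \<open>path\<close> the deviation fits into the rest.\<close>
  have inball: "w t \<in> cball w0 R" if "norm (w t - u t) \<le> \<eta> * \<gamma> * real t * exp (\<eta> * \<kappa> * real t)" "t \<le> T" for t
  proof -
    have "norm (w t - w0) \<le> norm (w t - u t) + norm (u t - w0)" by norm
    also have "\<dots> \<le> R" using that mono[of t] uR(2)[of t] path by linarith
    finally show ?thesis by (simp add: dist_norm norm_minus_commute)
  qed
  have step: "norm (w (Suc t) - u (Suc t)) \<le> (1 + \<eta> * \<kappa>) * norm (w t - u t) + \<eta> * \<gamma>"
    if wt: "w t \<in> cball w0 R" for t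
  proof -
    let ?d = "norm (w t - u t)"
    let ?Hw = "H' (w t)" and ?Gw = "G' (w t)" and ?Gu = "G' (u t)"
    note linGw = linear_deriv[OF wt] and linGu = linear_deriv[OF uR(1)[of t]]
    have adj_diff: "adjoint f z - adjoint f' z = adjoint (\<lambda>v. f v - f' v) z"
      if "linear f" "linear f'" for f f' :: "'a \<Rightarrow> 'b" and z
    proof (rule vector_eq_ldot[THEN iffD1, rule_format])
      fix v
      show "v \<bullet> (adjoint f z - adjoint f' z) = v \<bullet> adjoint (\<lambda>v. f v - f' v) z"
        using that by (simp add: inner_diff_right adjoint_works linear_compose_sub inner_diff_left)
    qed
    have J: "norm (?Hw v) \<le> (\<beta> + e') * norm v" for v
    proof -
      have "norm (?Hw v) \<le> norm (?Gw v) + norm (?Hw v - ?Gw v)" by norm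
      then show ?thesis using bound[OF wt, of v] H'[OF wt, of v] by (simp add: algebra_simps)
    qed
    have a: "norm (adjoint ?Hw ((H (w t) - y) - (G (u t) - y))) \<le> (\<beta> + e') * (e + \<beta> * ?d)"
    proof (rule order_trans[OF adjoint_norm_bound[OF lin J]], rule mult_left_mono)
      have "norm ((H (w t) - y) - (G (u t) - y)) \<le> norm (H (w t) - G (w t)) + norm (G (w t) - G (u t))"
        by norm
      then show "norm ((H (w t) - y) - (G (u t) - y)) \<le> e + \<beta> * ?d"
        using H[OF wt] lipschitz_map[OF wt uR(1)[of t]] by linarith
    qed (use nonneg in auto)
    have b: "norm (adjoint ?Hw (G (u t) - y) - adjoint ?Gw (G (u t) - y)) \<le> e' * r"
      unfolding adj_diff[OF lin linGw]
      by (rule order_trans[OF adjoint_norm_bound[OF linear_compose_sub[OF lin linGw] H'[OF wt]]])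
        (use res nonneg in \<open>auto intro: mult_left_mono\<close>)
    have c: "norm (adjoint ?Gw (G (u t) - y) - adjoint ?Gu (G (u t) - y)) \<le> L * ?d * r"
      unfolding adj_diff[OF linGw linGu]
      by (rule order_trans[OF adjoint_norm_bound[OF linear_compose_sub[OF linGw linGu] lipschitz[OF wt uR(1)]]])
        (use res nonneg in \<open>auto intro: mult_left_mono\<close>)
    have "w (Suc t) - u (Suc t) = (w t - u t) - \<eta> *\<^sub>R (adjoint ?Hw ((H (w t) - y) - (G (u t) - y))
        + (adjoint ?Hw (G (u t) - y) - adjoint ?Gw (G (u t) - y))
        + (adjoint ?Gw (G (u t) - y) - adjoint ?Gu (G (u t) - y)))"
      unfolding u w linear_diff[OF adjoint_linear[OF lin]] by (simp add: algebra_simps)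
    also have "norm \<dots> \<le> ?d + \<eta> * ((\<beta> + e') * (e + \<beta> * ?d) + e' * r + L * ?d * r)"
    proof (rule order_trans[OF norm_triangle_ineq4], rule add_left_mono)
      show "norm (\<eta> *\<^sub>R (adjoint ?Hw ((H (w t) - y) - (G (u t) - y))
          + (adjoint ?Hw (G (u t) - y) - adjoint ?Gw (G (u t) - y))
          + (adjoint ?Gw (G (u t) - y) - adjoint ?Gu (G (u t) - y))))
        \<le> \<eta> * ((\<beta> + e') * (e + \<beta> * ?d) + e' * r + L * ?d * r)"
        using mult_left_mono[OF norm_triangle_mono[OF norm_triangle_mono[OF a b] c] nonneg(6)] nonneg(6)
        by (simp only: norm_scaleR abs_of_nonneg)
    qed
    also have "\<dots> = (1 + \<eta> * \<kappa>) * ?d + \<eta> * \<gamma>" by (simp add: \<kappa> \<gamma> algebra_simps)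
    finally show ?thesis .
  qed
  have main: "norm (w t - u t) \<le> \<eta> * \<gamma> * real t * exp (\<eta> * \<kappa> * real t)" if "t \<le> T" for t
    using that
  \<comment> \<open>Strong induction: the recursion at \<open>s < t\<close> is available once
    \<open>w s\<close> lies in the ball, which the bound at \<open>s\<close> provides.\<close>
  proof (induction t rule: less_induct)
    case (less t)
    show ?case
    proof (rule exp_growth_recursion[where d = "\<lambda>t. norm (w t - u t)" and T = t])
      show "norm (w (Suc s) - u (Suc s)) \<le> (1 + \<eta> * \<kappa>) * norm (w s - u s) + \<eta> * \<gamma>" if "s < t" for s
        using that less by (intro step inball) auto
    qed (use \<kappa>0 \<gamma>0 nonneg in \<open>auto simp: u w\<close>)
  qed
  show ?thesis
    using main[OF t] mono[OF t] inball[OF main[OF t] t] by linarith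
qed

end

section \<open>The one-layer network\<close>

text \<open>Cauchy-Schwarz in each row; \<open>norm M\<close> is the Frobenius norm.\<close>

lemma norm_matrix_vector_le: "norm (M *v (x :: real^'a)) \<le> norm (M :: real^'a^'b) * norm x"
proof -
  have "norm (M *v x) \<le> norm (norm x *\<^sub>R (\<chi> i. norm (M $ i)))"
  proof (rule norm_le_componentwise_cart)
    fix i
    show "norm ((M *v x) $ i) \<le> norm ((norm x *\<^sub>R (\<chi> i. norm (M $ i))) $ i)"
      using Cauchy_Schwarz_ineq2[of "M $ i" x]
      by (simp add: matrix_vector_mul_component abs_mult mult.commute)
  qed
  moreover have "norm (\<chi> i. norm (M $ i)) = norm M"
    by (simp add: norm_vec_def)
  ultimately show ?thesis
    by (simp add: mult.commute)
qed

lemma norm_matrix_vector_le_opnorm: "norm (M *v x) \<le> opnorm M * norm x"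
  unfolding opnorm_def by (rule onorm[OF matrix_vector_mul_bounded_linear])

lemma opnorm_nonneg: "0 \<le> opnorm M"
  unfolding opnorm_def by (rule onorm_pos_le[OF matrix_vector_mul_bounded_linear])

lemma norm_mult_componentwise_le:
  fixes a :: "'a::finite \<Rightarrow> real"
  assumes "\<And>i. \<bar>a i\<bar> \<le> c * \<bar>b i\<bar>" "c \<ge> 0"
  shows "norm (\<chi> i. a i) \<le> c * norm (\<chi> i. b i)"
proof -
  have "norm (\<chi> i. a i) \<le> norm (c *\<^sub>R (\<chi> i. b i))"
    by (rule norm_le_componentwise_cart) (use assms in \<open>simp add: abs_mult\<close>)
  then show ?thesis using assms(2) by simp
qed

lemma abs_diff_le_deriv_bound:
  fixes f :: "real \<Rightarrow> real"
  assumes "\<And>t. f differentiable (at t)" "\<And>t. \<bar>deriv f t\<bar> \<le> B"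
  shows "\<bar>f s - f t\<bar> \<le> B * \<bar>s - t\<bar>"
  using field_differentiable_bound[of UNIV f "deriv f" B s t] assms
  by (simp add: DERIV_deriv_iff_real_differentiable)

section \<open>Vectorization and stacking\<close>

lemma inner_vec_mat [simp]: "vec_mat V \<bullet> vec_mat W = V \<bullet> W"
proof -
  have "(\<Sum>q\<in>UNIV. V $ snd q $ fst q * W $ snd q $ fst q) =
      (\<Sum>c\<in>UNIV. \<Sum>h\<in>UNIV. V $ h $ c * W $ h $ c)"
    by (simp add: sum.cartesian_product case_prod_beta flip: UNIV_Times_UNIV)
  then show ?thesis
    by (subst (asm) sum.swap) (simp add: vec_mat_def inner_vec_def)
qed

text \<open>Through this isometry, bounds on Jacobians in vectorized coordinates become bounds on
  derivatives in \<open>W\<close> under the Frobenius norm.\<close>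

lemma norm_vec_mat [simp]: "norm (vec_mat W) = norm W"
  by (simp add: norm_eq_sqrt_inner)

lemma linear_vec_mat: "linear vec_mat"
  by (rule linearI) (simp_all add: vec_mat_def vec_eq_iff)

lemma linear_unvec_mat: "linear unvec_mat"
  by (rule linearI) (simp_all add: unvec_mat_def vec_eq_iff)

lemma inner_stack: "stack u \<bullet> stack v = (\<Sum>i\<in>UNIV. u i \<bullet> v i)"
  by (simp add: stack_def inner_vec_def sum.cartesian_product case_prod_beta flip: UNIV_Times_UNIV)

lemma norm_stack_power2: "(norm (stack u))\<^sup>2 = (\<Sum>i\<in>UNIV. (norm (u i))\<^sup>2)"
  by (simp add: power2_norm_eq_inner inner_stack)

lemma stack_diff: "stack (\<lambda>i. u i - v i) = stack u - stack v"
  by (simp add: stack_def vec_eq_iff)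

lemma stack_add: "stack (\<lambda>i. u i + v i) = stack u + stack v"
  by (simp add: stack_def vec_eq_iff)

lemma stack_scaleR: "stack (\<lambda>i. c *\<^sub>R u i) = c *\<^sub>R stack u"
  by (simp add: stack_def vec_eq_iff)

lemma norm_le_norm_stack: "norm (u i) \<le> norm (stack u)"
proof (rule power2_le_imp_le)
  show "(norm (u i))\<^sup>2 \<le> (norm (stack u))\<^sup>2"
    unfolding norm_stack_power2 by (rule member_le_sum) auto
qed simp

lemma norm_stack_le:
  fixes u :: "'m::finite \<Rightarrow> real^'p"
  assumes "\<And>i. norm (u i) \<le> c"
  shows "norm (stack u) \<le> sqrt (real CARD('m)) * c"
proof (rule power2_le_imp_le)
  have c: "0 \<le> c" using assms[of undefined] norm_ge_zero order_trans by blast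
  have "(\<Sum>i\<in>(UNIV :: 'm set). (norm (u i))\<^sup>2) \<le> (\<Sum>i\<in>(UNIV :: 'm set). c\<^sup>2)"
    using assms by (intro sum_mono power_mono) auto
  then show "(norm (stack u))\<^sup>2 \<le> (sqrt (real CARD('m)) * c)\<^sup>2"
    by (simp add: norm_stack_power2 power_mult_distrib)
  show "0 \<le> sqrt (real CARD('m)) * c" using c by simp
qed

lemma has_derivative_vec_lambda:
  fixes f :: "'a::euclidean_space \<Rightarrow> 'i::finite \<Rightarrow> real"
  assumes "\<And>i. ((\<lambda>w. f w i) has_derivative f' i) (at w)"
  shows "((\<lambda>w. \<chi> i. f w i) has_derivative (\<lambda>v. \<chi> i. f' i v)) (at w)"
  using assms by (subst has_derivative_componentwise_within) (auto simp: Basis_vec_def inner_axis)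

text \<open>The argument order makes \<open>net_deriv A \<phi> x W\<close> the Frechet derivative in
  the weights at \<open>W\<close>, with the input \<open>x\<close> fixed and \<open>V\<close> as
  direction.\<close>

definition net_deriv ::
  "real^'h^'p \<Rightarrow> (real \<Rightarrow> real) \<Rightarrow> real^'p \<Rightarrow> real^'p^'h \<Rightarrow> real^'p^'h \<Rightarrow> real^'p" where
  "net_deriv A \<phi> x W V = A *v (\<chi> h. deriv \<phi> ((W *v x) $ h) * (V *v x) $ h)"

definition net_stack_deriv ::
  "real^'h^'p \<Rightarrow> (real \<Rightarrow> real) \<Rightarrow> ('m::finite \<Rightarrow> real^'p) \<Rightarrow> real^'p^'h \<Rightarrow> real^'p^'h
    \<Rightarrow> real^('m \<times> 'p)" where
  "net_stack_deriv A \<phi> v W V = stack (\<lambda>i. net_deriv A \<phi> (v i) W V)"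

lemma has_derivative_net:
  assumes "\<And>t. \<phi> differentiable (at t)"
  shows "((\<lambda>W. net A \<phi> W x) has_derivative net_deriv A \<phi> x W) (at W)"
  unfolding net_def net_deriv_def
proof (rule bounded_linear.has_derivative[OF matrix_vector_mul_bounded_linear],
    rule has_derivative_vec_lambda)
  fix h
  have "((\<lambda>W. (W *v x) $ h) has_derivative (\<lambda>V. (V *v x) $ h)) (at W)"
    unfolding matrix_vector_mul_component
    by (auto intro!: derivative_eq_intros bounded_linear.has_derivative[OF bounded_linear_vec_nth])
  moreover have "(\<phi> has_derivative (\<lambda>t. deriv \<phi> ((W *v x) $ h) * t)) (at ((W *v x) $ h))"
    using assms by (simp add: DERIV_deriv_iff_real_differentiable flip: has_field_derivative_def)
  ultimately show "((\<lambda>W. \<phi> ((W *v x) $ h)) has_derivative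
      (\<lambda>V. deriv \<phi> ((W *v x) $ h) * (V *v x) $ h)) (at W)"
    by (rule has_derivative_compose)
qed

lemma has_derivative_net_stack:
  assumes "\<And>t. \<phi> differentiable (at t)"
  shows "(net_stack A \<phi> v has_derivative net_stack_deriv A \<phi> v W) (at W)"
proof -
  have "((\<lambda>W. net A \<phi> W (v i) $ c) has_derivative (\<lambda>V. net_deriv A \<phi> (v i) W V $ c)) (at W)" for i c
    by (rule bounded_linear.has_derivative[OF bounded_linear_vec_nth has_derivative_net[OF assms]])
  then have "((\<lambda>W. \<chi> q. net A \<phi> W (v (fst q)) $ snd q) has_derivative
      (\<lambda>V. \<chi> q. net_deriv A \<phi> (v (fst q)) W V $ snd q)) (at W)"
    by (intro has_derivative_vec_lambda)
  then show ?thesis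
    unfolding net_stack_def[abs_def] net_stack_deriv_def[abs_def] stack_def .
qed

lemma linear_net_stack_deriv:
  assumes "\<And>t. \<phi> differentiable (at t)"
  shows "linear (net_stack_deriv A \<phi> v W)"
  using has_derivative_net_stack[OF assms] has_derivative_linear by blast

text \<open>Both sides are the derivative of the same map in vectorized coordinates, and derivatives
  are unique.\<close>

lemma net_jacobian_mult:
  assumes "\<And>t. \<phi> differentiable (at t)"
  shows "net_jacobian A \<phi> v W *v u = net_stack_deriv A \<phi> v W (unvec_mat u)"
proof -
  let ?f = "\<lambda>w. net_stack A \<phi> v (unvec_mat w)"
  have "(unvec_mat has_derivative unvec_mat) (at (vec_mat W))"
    using linear_unvec_mat bounded_linear_imp_has_derivative linear_conv_bounded_linear by blast
  then have d: "(?f has_derivative (\<lambda>u. net_stack_deriv A \<phi> v W (unvec_mat u))) (at (vec_mat W))"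
    using has_derivative_compose[where g = "net_stack A \<phi> v"] has_derivative_net_stack[OF assms]
    by (metis unvec_mat_vec_mat)
  then have "?f differentiable at (vec_mat W)" by (auto simp: differentiable_def)
  then have "(?f has_derivative (\<lambda>u. net_jacobian A \<phi> v W *v u)) (at (vec_mat W))"
    unfolding net_jacobian_def using jacobian_works by blast
  from has_derivative_unique[OF this d] show ?thesis by metis
qed

text \<open>Translates the vectorized gradient step into one with the adjoint on matrices; testing
  against an arbitrary \<open>u\<close> reduces it to the derivative itself.\<close>

lemma net_jacobian_transpose_mult:
  assumes "\<And>t. \<phi> differentiable (at t)"
  shows "transpose (net_jacobian A \<phi> v W) *v z = vec_mat (adjoint (net_stack_deriv A \<phi> v W) z)"
proof (rule vector_eq_ldot[THEN iffD1, rule_format])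
  fix u :: "real^('a \<times> 'b)"
  have "u \<bullet> (transpose (net_jacobian A \<phi> v W) *v z) = net_stack_deriv A \<phi> v W (unvec_mat u) \<bullet> z"
    by (metis net_jacobian_mult[OF assms] dot_lmul_matrix inner_commute transpose_matrix_vector)
  also have "\<dots> = vec_mat (unvec_mat u) \<bullet> vec_mat (adjoint (net_stack_deriv A \<phi> v W) z)"
    by (simp add: adjoint_works[OF linear_net_stack_deriv[OF assms]])
  finally show "u \<bullet> (transpose (net_jacobian A \<phi> v W) *v z) =
      u \<bullet> vec_mat (adjoint (net_stack_deriv A \<phi> v W) z)"
    by (simp only: vec_mat_unvec_mat)
qed

section \<open>Sensitivity to the input\<close>

lemma norm_net_diff_le:
  assumes "\<And>t. \<phi> differentiable (at t)" "\<And>t. \<bar>deriv \<phi> t\<bar> \<le> B\<^sub>1"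
  shows "norm (net A \<phi> W x - net A \<phi> W y) \<le> opnorm A * B\<^sub>1 * norm W * norm (x - y)"
proof -
  have B: "0 \<le> B\<^sub>1" using assms(2)[of 0] by simp
  have "net A \<phi> W x - net A \<phi> W y = A *v (\<chi> h. \<phi> ((W *v x) $ h) - \<phi> ((W *v y) $ h))"
    unfolding net_def matrix_vector_mult_diff_distrib[symmetric]
    by (rule arg_cong[where f = "(*v) A"]) (simp add: vec_eq_iff)
  also have "norm \<dots> \<le> opnorm A * norm (\<chi> h. \<phi> ((W *v x) $ h) - \<phi> ((W *v y) $ h))"
    by (rule norm_matrix_vector_le_opnorm)
  also have "\<dots> \<le> opnorm A * (B\<^sub>1 * norm (\<chi> h. (W *v (x - y)) $ h))"
    using B by (intro mult_left_mono opnorm_nonneg norm_mult_componentwise_le)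
      (auto simp: matrix_vector_mult_diff_distrib intro!: abs_diff_le_deriv_bound assms)
  also have "\<dots> \<le> opnorm A * (B\<^sub>1 * (norm W * norm (x - y)))"
    using B by (intro mult_left_mono opnorm_nonneg) (simp_all add: vec_lambda_eta norm_matrix_vector_le)
  finally show ?thesis by (simp add: mult.assoc)
qed

text \<open>The input enters twice, through the direction \<open>V *v x\<close> and through the
  slope of \<open>\<phi>\<close> at \<open>W *v x\<close>. The first change costs
  \<open>B\<^sub>1\<close>, the second \<open>B\<^sub>2\<close> by the mean value theorem.\<close>

lemma norm_net_deriv_diff_le:
  assumes "\<And>t. deriv \<phi> differentiable (at t)"
    and "\<And>t. \<bar>deriv \<phi> t\<bar> \<le> B\<^sub>1" "\<And>t. \<bar>deriv (deriv \<phi>) t\<bar> \<le> B\<^sub>2"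
  shows "norm (net_deriv A \<phi> x W V - net_deriv A \<phi> y W V)
    \<le> opnorm A * (B\<^sub>1 + B\<^sub>2 * norm W * norm y) * norm (x - y) * norm V"
proof -
  have B: "0 \<le> B\<^sub>1" "0 \<le> B\<^sub>2" using assms(2,3)[of 0] by simp_all
  \<comment> \<open>The split lets the slope difference multiply \<open>V *v y\<close>, so apart
    from \<open>x - y\<close> only the norm of \<open>y\<close>, later the clean input,
    enters.\<close>
  let ?a = "\<chi> h. deriv \<phi> ((W *v x) $ h) * (V *v (x - y)) $ h"
  let ?b = "\<chi> h. (deriv \<phi> ((W *v x) $ h) - deriv \<phi> ((W *v y) $ h)) * (V *v y) $ h"
  have eq: "net_deriv A \<phi> x W V - net_deriv A \<phi> y W V = A *v (?a + ?b)"
    unfolding net_deriv_def matrix_vector_mult_diff_distrib[symmetric]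
    by (rule arg_cong[where f = "(*v) A"])
      (simp add: vec_eq_iff matrix_vector_mult_diff_distrib left_diff_distrib right_diff_distrib)
  have "norm (net_deriv A \<phi> x W V - net_deriv A \<phi> y W V) \<le> opnorm A * norm (?a + ?b)"
    unfolding eq by (rule norm_matrix_vector_le_opnorm)
  also have "\<dots> \<le> opnorm A * (B\<^sub>1 * (norm V * norm (x - y)) + B\<^sub>2 * (norm W * norm (x - y)) * (norm V * norm y))"
  proof (rule mult_left_mono[OF norm_triangle_mono opnorm_nonneg])
    have "norm ?a \<le> B\<^sub>1 * norm (\<chi> h. (V *v (x - y)) $ h)"
      using B by (intro norm_mult_componentwise_le) (simp_all only: abs_mult mult_right_mono[OF assms(2)] abs_ge_zero)
    also have "\<dots> \<le> B\<^sub>1 * (norm V * norm (x - y))"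
      using B by (intro mult_left_mono) (simp_all add: vec_lambda_eta norm_matrix_vector_le)
    finally show "norm ?a \<le> B\<^sub>1 * (norm V * norm (x - y))" .
    have "\<bar>deriv \<phi> ((W *v x) $ h) - deriv \<phi> ((W *v y) $ h)\<bar> \<le> B\<^sub>2 * (norm W * norm (x - y))" for h
    proof -
      have "\<bar>deriv \<phi> ((W *v x) $ h) - deriv \<phi> ((W *v y) $ h)\<bar> \<le> B\<^sub>2 * \<bar>(W *v (x - y)) $ h\<bar>"
        unfolding matrix_vector_mult_diff_distrib vector_minus_component
        by (rule abs_diff_le_deriv_bound[OF assms(1,3)])
      also have "\<dots> \<le> B\<^sub>2 * (norm W * norm (x - y))"
        using B by (intro mult_left_mono order_trans[OF component_le_norm_cart norm_matrix_vector_le])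
      finally show ?thesis .
    qed
    then have "norm ?b \<le> B\<^sub>2 * (norm W * norm (x - y)) * norm (\<chi> h. (V *v y) $ h)"
      using B by (intro norm_mult_componentwise_le) (simp_all add: abs_mult mult_right_mono)
    also have "\<dots> \<le> B\<^sub>2 * (norm W * norm (x - y)) * (norm V * norm y)"
      using B by (intro mult_left_mono) (simp_all add: vec_lambda_eta norm_matrix_vector_le)
    finally show "norm ?b \<le> B\<^sub>2 * (norm W * norm (x - y)) * (norm V * norm y)" .
  qed
  finally show ?thesis by (simp add: algebra_simps)
qed

section \<open>Clusters\<close>

lemma sum_over_clusters: "(\<Sum>k\<in>UNIV. \<Sum>i | g i = k. h i) = (\<Sum>i\<in>UNIV. h i)"
  for g :: "'n::finite \<Rightarrow> 'k::finite"
  using sum.group[of UNIV UNIV g h] by simp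

lemma norm_stack_comp_power2:
  fixes g :: "'n::finite \<Rightarrow> 'k::finite"
  shows "(norm (stack (\<lambda>i. u (g i))))\<^sup>2 = (\<Sum>k\<in>UNIV. real (card {i. g i = k}) * (norm (u k))\<^sup>2)"
  unfolding norm_stack_power2 sum_over_clusters[symmetric, of _ g] by simp

text \<open>Passing from centers to samples repeats \<open>u k\<close> once per member of cluster
  \<open>k\<close>; hence the square root of the largest cluster size in the lifted
  constants.\<close>

lemma norm_stack_comp_le:
  fixes g :: "'n::finite \<Rightarrow> 'k::finite"
  assumes "\<And>k. card {i. g i = k} \<le> N"
  shows "norm (stack (\<lambda>i. u (g i))) \<le> sqrt (real N) * norm (stack u)"
proof (rule power2_le_imp_le)
  have "(norm (stack (\<lambda>i. u (g i))))\<^sup>2 \<le> (\<Sum>k\<in>UNIV. real N * (norm (u k))\<^sup>2)"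
    unfolding norm_stack_comp_power2 using assms by (intro sum_mono mult_right_mono) auto
  then show "(norm (stack (\<lambda>i. u (g i))))\<^sup>2 \<le> (sqrt (real N) * norm (stack u))\<^sup>2"
    by (simp add: power_mult_distrib norm_stack_power2 sum_distrib_left)
qed simp

text \<open>Squared, it compares \<open>N\<close> times each cluster size with the square of that
  size. It supplies the factor \<open>sqrt (real N)\<close> in the lower bound for the lifted
  adjoint.\<close>

lemma norm_stack_weighted_ge:
  fixes g :: "'n::finite \<Rightarrow> 'k::finite"
  assumes "\<And>k. N \<le> card {i. g i = k}"
  shows "sqrt (real N) * norm (stack (\<lambda>i. u (g i)))
    \<le> norm (stack (\<lambda>k. real (card {i. g i = k}) *\<^sub>R u k))"
proof (rule power2_le_imp_le)
  have "(\<Sum>k\<in>UNIV. real N * (real (card {i. g i = k}) * (norm (u k))\<^sup>2))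
      \<le> (\<Sum>k\<in>UNIV. real (card {i. g i = k}) * (real (card {i. g i = k}) * (norm (u k))\<^sup>2))"
    using assms by (intro sum_mono mult_right_mono) auto
  also have "\<dots> = (norm (stack (\<lambda>k. real (card {i. g i = k}) *\<^sub>R u k)))\<^sup>2"
    by (simp add: norm_stack_power2 power_mult_distrib power2_eq_square[of "real _"] mult.assoc)
  finally show "(sqrt (real N) * norm (stack (\<lambda>i. u (g i))))\<^sup>2
      \<le> (norm (stack (\<lambda>k. real (card {i. g i = k}) *\<^sub>R u k)))\<^sup>2"
    by (simp add: power_mult_distrib norm_stack_comp_power2 sum_distrib_left)
qed simp

lemma subspace_cluster_constant: "subspace (range (\<lambda>u. stack (\<lambda>i. u (g i))))" (is "subspace ?S")
proof (rule subspaceI)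
  show "0 \<in> ?S"
    by (rule range_eqI[where x = "\<lambda>k. 0"]) (simp add: stack_def vec_eq_iff)
next
  fix y z
  assume "y \<in> ?S" "z \<in> ?S"
  then obtain u v where "y = stack (\<lambda>i. u (g i))" "z = stack (\<lambda>i. v (g i))" by blast
  then show "y + z \<in> ?S"
    by (intro range_eqI[where x = "\<lambda>k. u k + v k"]) (simp add: stack_add)
next
  fix c y
  assume "y \<in> ?S"
  then obtain u where "y = stack (\<lambda>i. u (g i))" by blast
  then show "c *\<^sub>R y \<in> ?S"
    by (intro range_eqI[where x = "\<lambda>k. c *\<^sub>R u k"]) (simp add: stack_scaleR)
qed

text \<open>Each center collects the contributions of its cluster, so the lifted adjoint is the adjoint
  at the centers applied to the cluster-size weighted vector.\<close>

lemma adjoint_net_stack_deriv_comp: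
  fixes g :: "'n::finite \<Rightarrow> 'k::finite"
  assumes "\<And>t. \<phi> differentiable (at t)"
  shows "adjoint (net_stack_deriv A \<phi> (\<lambda>i. \<mu> (g i)) W) (stack (\<lambda>i. u (g i))) =
    adjoint (net_stack_deriv A \<phi> \<mu> W) (stack (\<lambda>k. real (card {i. g i = k}) *\<^sub>R u k))"
proof (rule vector_eq_ldot[THEN iffD1, rule_format])
  fix V
  have "net_stack_deriv A \<phi> (\<lambda>i. \<mu> (g i)) W V \<bullet> stack (\<lambda>i. u (g i)) =
      (\<Sum>k\<in>UNIV. \<Sum>i | g i = k. net_deriv A \<phi> (\<mu> (g i)) W V \<bullet> u (g i))"
    by (simp only: net_stack_deriv_def inner_stack sum_over_clusters)
  also have "\<dots> = net_stack_deriv A \<phi> \<mu> W V \<bullet> stack (\<lambda>k. real (card {i. g i = k}) *\<^sub>R u k)"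
    by (simp add: net_stack_deriv_def inner_stack)
  finally show "V \<bullet> adjoint (net_stack_deriv A \<phi> (\<lambda>i. \<mu> (g i)) W) (stack (\<lambda>i. u (g i))) =
      V \<bullet> adjoint (net_stack_deriv A \<phi> \<mu> W) (stack (\<lambda>k. real (card {i. g i = k}) *\<^sub>R u k))"
    by (simp add: adjoint_works[OF linear_net_stack_deriv[OF assms]])
qed

text \<open>Lifted along \<open>g\<close>, this is the orthogonal projection of the data onto the
  vectors that are constant on clusters.\<close>

definition cluster_mean :: "('n::finite \<Rightarrow> 'k) \<Rightarrow> ('n \<Rightarrow> 'a::real_vector) \<Rightarrow> 'k \<Rightarrow> 'a" where
  "cluster_mean g x k = (\<Sum>i | g i = k. x i) /\<^sub>R real (card {i. g i = k})"

text \<open>Deviations from the mean sum to zero within each cluster, so pairing them with a vector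
  constant there gives nothing.\<close>

lemma stack_comp_orthogonal_residual:
  fixes g :: "'n::finite \<Rightarrow> 'k::finite"
  shows "stack (\<lambda>i. u (g i)) \<bullet> (stack x - stack (\<lambda>i. cluster_mean g x (g i))) = 0"
proof -
  have zero: "(\<Sum>i | g i = k. x i - cluster_mean g x k) = 0" for k
    by (cases "{i. g i = k} = {}") (simp_all add: cluster_mean_def sum_subtractf sum_constant_scaleR del: sum_constant)
  have "stack (\<lambda>i. u (g i)) \<bullet> (stack x - stack (\<lambda>i. cluster_mean g x (g i))) =
      (\<Sum>k\<in>UNIV. \<Sum>i | g i = k. u (g i) \<bullet> (x i - cluster_mean g x (g i)))"
    by (simp only: inner_stack sum_over_clusters stack_diff[symmetric])
  also have "\<dots> = (\<Sum>k\<in>UNIV. u k \<bullet> (\<Sum>i | g i = k. x i - cluster_mean g x k))"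
    by (simp add: inner_sum_right)
  finally show ?thesis by (simp add: zero)
qed

text \<open>What remains of \<open>x\<close> after removing \<open>\<xi>\<close> is supported on
  \<open>S\<close>; averaging weighs it by the share of \<open>S\<close> in the cluster, so large
  errors on few samples cost only \<open>\<rho> * b\<close>.\<close>

lemma norm_cluster_mean_le:
  fixes g :: "'n::finite \<Rightarrow> 'k" and x :: "'n \<Rightarrow> 'a::real_normed_vector"
  assumes "{i. g i = k} \<noteq> {}"
    and "\<And>i. norm (x i - \<xi> i) \<le> (if i \<in> S then b else 0)" "\<And>i. norm (\<xi> i) \<le> a"
    and "real (card (S \<inter> {i. g i = k})) / real (card {i. g i = k}) \<le> \<rho>" "0 \<le> b"
  shows "norm (cluster_mean g x k) \<le> a + \<rho> * b"
proof -
  let ?C = "{i. g i = k}"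
  have c: "card ?C > 0" using assms(1) by (simp add: card_gt_0_iff)
  have "norm (\<Sum>i\<in>?C. x i) \<le> (\<Sum>i\<in>?C. a + (if i \<in> S then b else 0))"
  proof (rule sum_norm_le)
    fix i
    show "norm (x i) \<le> a + (if i \<in> S then b else 0)"
      using norm_triangle_mono[OF assms(3) assms(2), of i i] by simp
  qed
  also have "\<dots> = real (card ?C) * a + real (card (S \<inter> ?C)) * b"
    by (simp add: sum.distrib sum.If_cases Int_commute)
  finally have "norm (cluster_mean g x k)
      \<le> (real (card ?C) * a + real (card (S \<inter> ?C)) * b) / real (card ?C)"
    by (simp add: cluster_mean_def divide_right_mono divide_inverse_commute mult_left_mono)
  also have "\<dots> = a + real (card (S \<inter> ?C)) / real (card ?C) * b"
    using assms(1) by (simp add: add_divide_distrib)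
  also have "\<dots> \<le> a + \<rho> * b" using assms(4,5) by (intro add_left_mono mult_right_mono)
  finally show ?thesis .
qed

lemma cluster_mean_diff_const:
  assumes "{i. g i = k} \<noteq> {}"
  shows "cluster_mean g (\<lambda>i. x i - \<mu> (g i)) k = cluster_mean g x k - \<mu> k"
proof -
  have "(\<Sum>i | g i = k. \<mu> (g i)) = real (card {i. g i = k}) *\<^sub>R \<mu> k" by (simp add: sum_constant_scaleR del: sum_constant)
  moreover have "card {i. g i = k} \<noteq> 0" using assms by simp
  ultimately show ?thesis
    by (simp add: cluster_mean_def sum_subtractf scaleR_diff_right)
qed

text \<open>Clear denominators and sum over the clusters, which partition the samples.\<close>

lemma card_clusterwise_le:
  fixes g :: "'n::finite \<Rightarrow> 'k::finite"
  assumes "\<And>k. {i. g i = k} \<noteq> {}"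
    and "\<And>k. real (card (S \<inter> {i. g i = k})) / real (card {i. g i = k}) \<le> \<rho>"
  shows "real (card S) \<le> \<rho> * real CARD('n)"
proof -
  have "card {i. g i = k} > 0" for k using assms(1) by (simp add: card_gt_0_iff)
  then have le: "real (card (S \<inter> {i. g i = k})) \<le> \<rho> * real (card {i. g i = k})" for k
    using assms(2)[of k] by (simp add: pos_divide_le_eq)
  have card_eq: "(\<Sum>k\<in>UNIV. real (card (S \<inter> {i. g i = k}))) = real (card S)" for S :: "'n set"
    using sum_over_clusters[where g = g and h = "\<lambda>i. if i \<in> S then 1 else 0 :: real"]
    by (simp add: sum.If_cases Int_commute)
  have "(\<Sum>k\<in>UNIV. real (card (S \<inter> {i. g i = k}))) \<le> (\<Sum>k\<in>UNIV. \<rho> * real (card {i. g i = k}))"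
    by (rule sum_mono[OF le])
  then show ?thesis
    using card_eq[of S] card_eq[of UNIV] by (simp flip: sum_distrib_left)
qed

text \<open>Only indices in \<open>S\<close> contribute to the squared norm, each at most
  \<open>b\<^sup>2\<close>. This yields the term
  \<open>sqrt (\<rho> * n) * \<epsilon>\<^sub>o\<close> of \<open>Rhat\<^sub>0\<close>.\<close>

lemma norm_stack_sparse_le:
  fixes u :: "'n::finite \<Rightarrow> real^'p"
  assumes "\<And>i. norm (u i) \<le> (if i \<in> S then b else 0)" "real (card S) \<le> N" "0 \<le> b"
  shows "norm (stack u) \<le> sqrt N * b"
proof (rule power2_le_imp_le)
  have N: "0 \<le> N" using assms(2) of_nat_0_le_iff order_trans by blast
  have "(norm (stack u))\<^sup>2 \<le> (\<Sum>i\<in>UNIV. (if i \<in> S then b else 0)\<^sup>2)"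
    unfolding norm_stack_power2 using assms(1) by (intro sum_mono power_mono) auto
  also have "\<dots> = real (card S) * b\<^sup>2"
    by (simp add: if_distrib[of "\<lambda>x. x\<^sup>2"] sum.If_cases cong: if_cong)
  also have "\<dots> \<le> (sqrt N * b)\<^sup>2"
    using assms(2) N by (simp add: power_mult_distrib mult_right_mono)
  finally show "(norm (stack u))\<^sup>2 \<le> (sqrt N * b)\<^sup>2" .
  show "0 \<le> sqrt N * b" using N assms(3) by simp
qed

text \<open>Uses \<open>1 - a \<le> exp (- a)\<close>; \<open>a \<le> 1\<close> keeps the base
  nonnegative, so powers preserve the inequality.\<close>

lemma geometric_decay_le:
  fixes a R \<nu> :: real
  assumes "a \<le> 1" "0 < R" "0 < \<nu>" "ln (R / \<nu>) \<le> a * real T"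
  shows "(1 - a) ^ T * R \<le> \<nu>"
proof -
  have "(1 - a) ^ T \<le> exp (- a) ^ T"
    using assms exp_ge_add_one_self[of "- a"] by (intro power_mono) auto
  also have "\<dots> = exp (- (a * real T))" by (simp add: exp_of_nat_mult[symmetric] mult.commute)
  also have "\<dots> \<le> exp (- ln (R / \<nu>))" using assms by simp
  also have "\<dots> = \<nu> / R" using assms by (simp add: exp_minus)
  finally show ?thesis using assms by (simp add: field_simps)
qed

section \<open>Detection of outliers\<close>

theorem corollaryA12:
  fixes \<mu> :: "'k::finite \<Rightarrow> real^'p::finite"
    and g :: "'n::finite \<Rightarrow> 'k"
    and x x' \<xi> out :: "'n \<Rightarrow> real^'p"
    and A :: "real^'h::finite^'p"
    and \<phi> :: "real \<Rightarrow> real"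
    and W\<^sub>0 :: "real^'p^'h" and W :: "nat \<Rightarrow> real^'p^'h"
    and \<D> :: "(real^'p^'h) set"
    and \<Lambda> :: "'k \<Rightarrow> 'n set" and \<O> :: "'n set"
    and J :: "real^'p^'h \<Rightarrow> real^('p \<times> 'h)^('n \<times> 'p)"
    and J\<^sub>c :: "real^'p^'h \<Rightarrow> real^('p \<times> 'h)^('k \<times> 'p)"
    and n\<^sub>m\<^sub>i\<^sub>n n\<^sub>m\<^sub>a\<^sub>x T :: nat
    and n \<epsilon>\<^sub>c \<epsilon>\<^sub>o \<rho> \<alpha>\<^sub>c \<beta>\<^sub>c L\<^sub>c \<alpha> \<beta> L B\<^sub>1 B\<^sub>2 \<eta> R\<^sub>l\<^sub>o\<^sub>c R'\<^sub>0 Rhat\<^sub>0 R\<^sub>\<mu> R\<^sub>W :: real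
    and \<Delta>\<^sub>f \<Delta>\<^sub>J \<beta>\<^sub>X \<kappa> \<gamma> :: real
    and T_star :: "real \<Rightarrow> int"
    and \<Delta>_path \<zeta> :: "nat \<Rightarrow> real"
    and \<delta> :: ereal
  (* data *)
  assumes n: "n = real CARD('n)"
    and Lambda: "\<And>k. \<Lambda> k = {i. g i = k}"
    and nonempty: "\<And>k. card (\<Lambda> k) \<ge> 1"
    and n_min: "n\<^sub>m\<^sub>i\<^sub>n = (MIN k. card (\<Lambda> k))"
    and n_max: "n\<^sub>m\<^sub>a\<^sub>x = (MAX k. card (\<Lambda> k))"
    and clean: "\<And>i. x' i = \<mu> (g i)"
    and samples: "\<And>i. x i = x' i + \<xi> i + out i"
    and outliers: "\<O> = {i. out i \<noteq> 0}"
  (* model and gradient descent *)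
    and J: "\<And>V. J V = net_jacobian A \<phi> x V"
    and Jc: "\<And>V. J\<^sub>c V = net_jacobian A \<phi> \<mu> V"
    and R_loc_pos: "R\<^sub>l\<^sub>o\<^sub>c > 0"
    and D: "\<D> = {V. norm (V - W\<^sub>0) \<le> R\<^sub>l\<^sub>o\<^sub>c}"
    and gd_init: "W 0 = W\<^sub>0"
    and gd_step: "\<And>\<tau>. vec_mat (W (Suc \<tau>)) =
        vec_mat (W \<tau>) - \<eta> *\<^sub>R (transpose (J (W \<tau>)) *v (net_stack A \<phi> x (W \<tau>) - stack x))"
  (* derived constants *)
    and alpha: "\<alpha> = sqrt n\<^sub>m\<^sub>i\<^sub>n * \<alpha>\<^sub>c"
    and beta: "\<beta> = sqrt n\<^sub>m\<^sub>a\<^sub>x * \<beta>\<^sub>c"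
    and L: "L = sqrt n\<^sub>m\<^sub>a\<^sub>x * L\<^sub>c"
    and R'0: "R'\<^sub>0 = norm (net_stack A \<phi> x' W\<^sub>0 - stack x')"
    and Rhat0: "Rhat\<^sub>0 = R'\<^sub>0 + sqrt n * \<epsilon>\<^sub>c + sqrt (\<rho> * n) * \<epsilon>\<^sub>o"
    and T_star: "\<And>\<nu>. \<nu> > 0 \<Longrightarrow> T_star \<nu> = \<lceil>2 / (\<eta> * \<alpha>\<^sup>2) * log_plus (Rhat\<^sub>0 / \<nu>)\<rceil>"
    and R_mu: "R\<^sub>\<mu> = (MAX k. norm (\<mu> k))"
    and R_W: "R\<^sub>W = norm W\<^sub>0 + R\<^sub>l\<^sub>o\<^sub>c"
    and Delta_f: "\<Delta>\<^sub>f = opnorm A * B\<^sub>1 * R\<^sub>W * (\<epsilon>\<^sub>c + \<epsilon>\<^sub>o)"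
    and Delta_J: "\<Delta>\<^sub>J = sqrt n * opnorm A * (B\<^sub>1 + B\<^sub>2 * R\<^sub>W * R\<^sub>\<mu>) * (\<epsilon>\<^sub>c + \<epsilon>\<^sub>o)"
    and beta_X: "\<beta>\<^sub>X = \<beta> + \<Delta>\<^sub>J"
    and kappa: "\<kappa> = L * Rhat\<^sub>0 + \<beta> * \<beta>\<^sub>X"
    and gamma: "\<gamma> = \<Delta>\<^sub>J * Rhat\<^sub>0 + \<beta>\<^sub>X * sqrt n * \<Delta>\<^sub>f"
    and Delta_path: "\<And>t. \<Delta>_path t = \<eta> * \<gamma> * real t * exp (\<eta> * \<kappa> * real t)"
    and zeta: "\<And>t. \<zeta> t = \<Delta>\<^sub>f + \<beta> * \<Delta>_path t"
    and delta: "\<delta> = center_separation \<mu>"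
  (* hypotheses (1)-(8) *)
    and h1: "\<epsilon>\<^sub>c \<ge> 0" "\<And>i. norm (\<xi> i) \<le> \<epsilon>\<^sub>c"
    and h2: "\<rho> > 0" "(MAX k. real (card (\<O> \<inter> \<Lambda> k)) / real (card (\<Lambda> k))) \<le> \<rho>"
    and h3: "\<epsilon>\<^sub>o \<ge> 0" "\<And>i. i \<in> \<O> \<Longrightarrow> norm (out i) \<le> \<epsilon>\<^sub>o" "\<epsilon>\<^sub>c + \<rho> * \<epsilon>\<^sub>o > 0"
    and h4: "\<alpha>\<^sub>c > 0" "\<beta>\<^sub>c > 0" "L\<^sub>c > 0"
      "\<And>V z. V \<in> \<D> \<Longrightarrow> norm z = 1 \<Longrightarrow>
        \<alpha>\<^sub>c \<le> norm (transpose (J\<^sub>c V) *v z) \<and> norm (transpose (J\<^sub>c V) *v z) \<le> \<beta>\<^sub>c"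
      "\<And>V\<^sub>1 V\<^sub>2. V\<^sub>1 \<in> \<D> \<Longrightarrow> V\<^sub>2 \<in> \<D> \<Longrightarrow>
        opnorm (J\<^sub>c V\<^sub>1 - J\<^sub>c V\<^sub>2) \<le> L\<^sub>c * norm (V\<^sub>1 - V\<^sub>2)"
    and h5: "R\<^sub>l\<^sub>o\<^sub>c \<ge> 2 * \<beta> / \<alpha>\<^sup>2 * Rhat\<^sub>0"
    and h6: "\<And>t. \<phi> differentiable (at t)" "\<And>t. deriv \<phi> differentiable (at t)"
      "\<And>t. \<bar>deriv \<phi> t\<bar> \<le> B\<^sub>1" "\<And>t. \<bar>deriv (deriv \<phi>) t\<bar> \<le> B\<^sub>2"
    and h7: "0 < \<eta>" "\<eta> \<le> min (\<alpha>\<^sup>2 / (8 * \<beta> ^ 4)) (\<alpha>\<^sup>2 / (2 * L * \<beta>\<^sup>2 * Rhat\<^sub>0))"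
    and h8: "int T \<ge> T_star (\<epsilon>\<^sub>c + \<rho> * \<epsilon>\<^sub>o)"
      "\<Delta>_path T \<le> R\<^sub>l\<^sub>o\<^sub>c - 2 * \<beta> / \<alpha>\<^sup>2 * Rhat\<^sub>0"
      "\<delta> > ereal (2 * \<zeta> T + 4 * (\<epsilon>\<^sub>c + \<rho> * \<epsilon>\<^sub>o))"
  shows "(\<forall>i. i \<notin> \<O> \<longrightarrow>
            norm (net A \<phi> (W T) (x i) - x i) \<le> \<zeta> T + 3 * \<epsilon>\<^sub>c + 2 * \<rho> * \<epsilon>\<^sub>o) \<and>
         (\<forall>i\<in>\<O>. norm (net A \<phi> (W T) (x i) - x i) \<ge> norm (out i) - \<zeta> T - 3 * \<epsilon>\<^sub>c - 2 * \<rho> * \<epsilon>\<^sub>o) \<and>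
         (\<forall>i\<in>\<O>. ereal (norm (out i)) > \<delta> + ereal (2 * \<epsilon>\<^sub>c) \<longrightarrow>
            (\<forall>j. j \<notin> \<O> \<longrightarrow>
              norm (net A \<phi> (W T) (x i) - x i) > norm (net A \<phi> (W T) (x j) - x j)))"
proof -

  \<comment> \<open>The two training problems\<close>
  define ys where "ys = stack (\<lambda>i. cluster_mean g x (g i))"
  define S where "S = range (\<lambda>u :: 'k \<Rightarrow> real^'p. stack (\<lambda>i. u (g i)))"
  \<comment> \<open>\<open>G\<close> is the reference model on clean inputs and \<open>H\<close> the
    trained model on noisy inputs; both are fitted to \<open>stack x\<close>.\<close>
  define G where "G = net_stack A \<phi> x'"
  define G' where "G' = net_stack_deriv A \<phi> x'"
  define H where "H = net_stack A \<phi> x"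
  define H' where "H' = net_stack_deriv A \<phi> x"
  define \<nu> where "\<nu> = \<epsilon>\<^sub>c + \<rho> * \<epsilon>\<^sub>o"
  have x'_eq: "x' = (\<lambda>i. \<mu> (g i))" using clean by auto
  have D_eq: "\<D> = cball W\<^sub>0 R\<^sub>l\<^sub>o\<^sub>c" unfolding D by (auto simp: dist_norm norm_minus_commute)
  have \<nu>: "\<nu> > 0" using h3 by (simp add: \<nu>_def)
  have card_pos: "0 < card {i. g i = k}" for k using nonempty[of k] by (simp add: Lambda)
  then have cluster_ne: "{i. g i = k} \<noteq> {}" for k by (simp add: card_gt_0_iff)
  have card_min: "n\<^sub>m\<^sub>i\<^sub>n \<le> card {i. g i = k}" for k unfolding n_min Lambda by simp
  have card_max: "card {i. g i = k} \<le> n\<^sub>m\<^sub>a\<^sub>x" for k unfolding n_max Lambda by simp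
  have nmin1: "1 \<le> n\<^sub>m\<^sub>i\<^sub>n" unfolding n_min using nonempty by simp
  have nmin_max: "n\<^sub>m\<^sub>i\<^sub>n \<le> n\<^sub>m\<^sub>a\<^sub>x" using card_min card_max order_trans by blast
  have n0: "0 \<le> n" by (simp add: n)

  \<comment> \<open>The Jacobian at the cluster centers\<close>
  have lin\<mu>: "linear (net_stack_deriv A \<phi> \<mu> V)" for V
    by (rule linear_net_stack_deriv[OF h6(1)])
  have Jc_adj: "\<alpha>\<^sub>c * norm z \<le> norm (adjoint (net_stack_deriv A \<phi> \<mu> V) z)"
      "norm (adjoint (net_stack_deriv A \<phi> \<mu> V) z) \<le> \<beta>\<^sub>c * norm z"
    if V: "V \<in> cball W\<^sub>0 R\<^sub>l\<^sub>o\<^sub>c" for V z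
  proof -
    have norm_adj: "norm (transpose (J\<^sub>c V) *v z) = norm (adjoint (net_stack_deriv A \<phi> \<mu> V) z)" for z
      unfolding Jc net_jacobian_transpose_mult[OF h6(1)] by simp
    have "\<alpha>\<^sub>c * norm z \<le> norm (adjoint (net_stack_deriv A \<phi> \<mu> V) z) \<and>
        norm (adjoint (net_stack_deriv A \<phi> \<mu> V) z) \<le> \<beta>\<^sub>c * norm z"
    proof (cases "z = 0")
      case True
      then show ?thesis using linear_0[OF adjoint_linear[OF lin\<mu>]] by simp
    next
      case False
      \<comment> \<open>The hypothesis speaks of unit vectors; homogeneity extends it to all
        \<open>z\<close>.\<close>
      then have u: "norm (z /\<^sub>R norm z) = 1" by simp
      have z: "norm (adjoint (net_stack_deriv A \<phi> \<mu> V) (z /\<^sub>R norm z)) =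
          norm (adjoint (net_stack_deriv A \<phi> \<mu> V) z) / norm z"
        by (simp add: linear_scale[OF adjoint_linear[OF lin\<mu>]] divide_inverse_commute)
      show ?thesis
        using h4(4)[OF V[folded D_eq] u] False unfolding norm_adj z
        by (simp add: pos_le_divide_eq pos_divide_le_eq)
    qed
    then show "\<alpha>\<^sub>c * norm z \<le> norm (adjoint (net_stack_deriv A \<phi> \<mu> V) z)"
      "norm (adjoint (net_stack_deriv A \<phi> \<mu> V) z) \<le> \<beta>\<^sub>c * norm z" by auto
  qed
  have Jc_bound: "norm (net_stack_deriv A \<phi> \<mu> V v) \<le> \<beta>\<^sub>c * norm v"
    if "V \<in> cball W\<^sub>0 R\<^sub>l\<^sub>o\<^sub>c" for V v
    \<comment> \<open>The hypothesis bounds the transpose; a second adjoint carries the bound over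
      to the derivative.\<close>
    using adjoint_norm_bound[OF adjoint_linear[OF lin\<mu>] Jc_adj(2)[OF that]]
    by (simp add: adjoint_adjoint[OF lin\<mu>])
  have Jc_lip: "norm (net_stack_deriv A \<phi> \<mu> V v - net_stack_deriv A \<phi> \<mu> V' v)
      \<le> L\<^sub>c * norm (V - V') * norm v"
    if "V \<in> cball W\<^sub>0 R\<^sub>l\<^sub>o\<^sub>c" "V' \<in> cball W\<^sub>0 R\<^sub>l\<^sub>o\<^sub>c" for V V' v
  proof -
    have "(J\<^sub>c V - J\<^sub>c V') *v vec_mat v = net_stack_deriv A \<phi> \<mu> V v - net_stack_deriv A \<phi> \<mu> V' v"
      by (simp add: Jc matrix_vector_mult_diff_rdistrib net_jacobian_mult[OF h6(1)] unvec_mat_vec_mat)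
    then have "norm (net_stack_deriv A \<phi> \<mu> V v - net_stack_deriv A \<phi> \<mu> V' v)
        \<le> opnorm (J\<^sub>c V - J\<^sub>c V') * norm v"
      using norm_matrix_vector_le_opnorm[of "J\<^sub>c V - J\<^sub>c V'" "vec_mat v"] by simp
    also have "\<dots> \<le> L\<^sub>c * norm (V - V') * norm v"
      using h4(5) that by (intro mult_right_mono) (auto simp: D_eq)
    finally show ?thesis .
  qed
  have W0: "W\<^sub>0 \<in> cball W\<^sub>0 R\<^sub>l\<^sub>o\<^sub>c" using R_loc_pos by simp
  have "\<alpha>\<^sub>c \<le> \<beta>\<^sub>c"
  proof -
    \<comment> \<open>A unit vector at \<open>W\<^sub>0\<close> has its image norm between the two
      constants.\<close>
    obtain z :: "real^('k \<times> 'p)" where "norm z = 1" using vector_choose_size[of 1] by auto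
    then show ?thesis using h4(4)[of W\<^sub>0 z] W0 by (simp add: D_eq)
  qed
  then have \<alpha>: "0 < \<alpha>" "\<alpha> \<le> \<beta>"
    unfolding alpha beta using h4(1) nmin1 nmin_max by (auto intro!: mult_mono)
  have L_pos: "0 < L" unfolding L using h4(3) nmin1 nmin_max by simp
  have \<beta>0: "0 \<le> \<beta>" using \<alpha> by simp

  \<comment> \<open>Lifting from the centers to the samples\<close>
  have G'_eq: "G' V v = stack (\<lambda>i. net_deriv A \<phi> (\<mu> (g i)) V v)" for V v
    by (simp add: G'_def net_stack_deriv_def x'_eq)
  have lip: "lipschitz_jacobian G G' W\<^sub>0 R\<^sub>l\<^sub>o\<^sub>c \<beta> L"
  proof
    fix V assume V: "V \<in> cball W\<^sub>0 R\<^sub>l\<^sub>o\<^sub>c"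
    show "(G has_derivative G' V) (at V)"
      unfolding G_def G'_def by (rule has_derivative_net_stack[OF h6(1)])
    fix v
    have "norm (G' V v) \<le> sqrt n\<^sub>m\<^sub>a\<^sub>x * norm (net_stack_deriv A \<phi> \<mu> V v)"
      unfolding G'_eq net_stack_deriv_def by (rule norm_stack_comp_le[OF card_max])
    also have "\<dots> \<le> sqrt n\<^sub>m\<^sub>a\<^sub>x * (\<beta>\<^sub>c * norm v)" by (intro mult_left_mono Jc_bound V) simp
    finally show "norm (G' V v) \<le> \<beta> * norm v" by (simp add: beta mult.assoc)
  next
    fix V V' v assume V: "V \<in> cball W\<^sub>0 R\<^sub>l\<^sub>o\<^sub>c" "V' \<in> cball W\<^sub>0 R\<^sub>l\<^sub>o\<^sub>c"
    have "norm (G' V v - G' V' v)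
        \<le> sqrt n\<^sub>m\<^sub>a\<^sub>x * norm (net_stack_deriv A \<phi> \<mu> V v - net_stack_deriv A \<phi> \<mu> V' v)"
      unfolding G'_eq net_stack_deriv_def stack_diff[symmetric] by (rule norm_stack_comp_le[OF card_max])
    also have "\<dots> \<le> sqrt n\<^sub>m\<^sub>a\<^sub>x * (L\<^sub>c * norm (V - V') * norm v)" by (intro mult_left_mono Jc_lip V) simp
    finally show "norm (G' V v - G' V' v) \<le> L * norm (V - V') * norm v" by (simp add: L mult.assoc)
  qed
  have lower: "\<alpha> * norm z \<le> norm (adjoint (G' V) z)" if V: "V \<in> cball W\<^sub>0 R\<^sub>l\<^sub>o\<^sub>c" and "z \<in> S" for V z
  proof -
    obtain u :: "'k \<Rightarrow> real^'p" where u: "z = stack (\<lambda>i. u (g i))" using \<open>z \<in> S\<close> unfolding S_def by blast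
    have "\<alpha> * norm z = \<alpha>\<^sub>c * (sqrt n\<^sub>m\<^sub>i\<^sub>n * norm z)" by (simp add: alpha)
    also have "\<dots> \<le> \<alpha>\<^sub>c * norm (stack (\<lambda>k. real (card {i. g i = k}) *\<^sub>R u k))"
      unfolding u using h4(1) by (intro mult_left_mono norm_stack_weighted_ge card_min) simp
    also have "\<dots> \<le> norm (adjoint (G' V) z)"
      unfolding u G'_def x'_eq adjoint_net_stack_deriv_comp[OF h6(1)] by (rule Jc_adj(1)[OF V])
    finally show ?thesis .
  qed

  \<comment> \<open>Size of the noise\<close>
  have noise_bound: "norm (out i) \<le> (if i \<in> \<O> then \<epsilon>\<^sub>o else 0)" for i
    using h3(2) by (auto simp: outliers)
  have \<rho>_cluster: "real (card (\<O> \<inter> {i. g i = k})) / real (card {i. g i = k}) \<le> \<rho>" for k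
  proof -
    have "real (card (\<O> \<inter> \<Lambda> k)) / real (card (\<Lambda> k)) \<le>
        (MAX k. real (card (\<O> \<inter> \<Lambda> k)) / real (card (\<Lambda> k)))" by (rule Max_ge) auto
    then show ?thesis using h2(2) unfolding Lambda by linarith
  qed
  have data_noise: "norm (stack x - stack x') \<le> sqrt n * \<epsilon>\<^sub>c + sqrt (\<rho> * n) * \<epsilon>\<^sub>o"
  proof -
    have "stack x - stack x' = stack \<xi> + stack out"
      by (simp add: samples[abs_def] flip: stack_diff stack_add)
    moreover have "norm (stack \<xi>) \<le> sqrt n * \<epsilon>\<^sub>c" unfolding n by (rule norm_stack_le[OF h1(2)])
    moreover have "norm (stack out) \<le> sqrt (\<rho> * n) * \<epsilon>\<^sub>o"
      unfolding n by (rule norm_stack_sparse_le[OF noise_bound card_clusterwise_le[OF cluster_ne \<rho>_cluster] h3(1)])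
    ultimately show ?thesis using norm_triangle_mono by metis
  qed
  have mean_bound: "norm (cluster_mean g x k - \<mu> k) \<le> \<nu>" for k
    \<comment> \<open>Subtracting the centers before averaging leaves the pure noise
      \<open>\<xi> i + out i\<close>.\<close>
    unfolding cluster_mean_diff_const[OF cluster_ne, symmetric] \<nu>_def
    by (rule norm_cluster_mean_le[where \<xi> = \<xi>, OF cluster_ne _ h1(2) \<rho>_cluster h3(1)])
      (use noise_bound in \<open>simp add: samples clean\<close>)

  \<comment> \<open>Initial residual and orthogonal splitting\<close>
  have R0: "norm (G W\<^sub>0 - stack x) \<le> Rhat\<^sub>0"
  proof -
    have "norm (G W\<^sub>0 - stack x) \<le> norm (G W\<^sub>0 - stack x') + norm (stack x - stack x')" by norm
    then show ?thesis using data_noise unfolding Rhat0 R'0 G_def by linarith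
  qed
  have \<eta>: "\<eta> \<le> \<alpha>\<^sup>2 / (8 * \<beta> ^ 4)" "\<eta> \<le> \<alpha>\<^sup>2 / (2 * L * \<beta>\<^sup>2 * Rhat\<^sub>0)" using h7(2) by auto
  have Rhat_pos: "0 < Rhat\<^sub>0" by (rule step_size_radius_pos[OF h7(1) \<eta>(2) L_pos])
  have subS: "subspace S" unfolding S_def by (rule subspace_cluster_constant)
  have GS: "G V \<in> S" for V
    unfolding S_def G_def net_stack_def x'_eq by (rule range_eqI[where x = "\<lambda>k. net A \<phi> V (\<mu> k)"]) simp
  have G'S: "G' V v \<in> S" for V v
    unfolding S_def G'_eq by (rule range_eqI[where x = "\<lambda>k. net_deriv A \<phi> (\<mu> k) V v"]) simp
  have ysS: "ys \<in> S" unfolding S_def ys_def by simp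
  have orth: "z \<bullet> (ys - stack x) = 0" "z \<bullet> (stack x - ys) = 0" if "z \<in> S" for z
    using that stack_comp_orthogonal_residual[of _ g x]
    by (auto simp: S_def ys_def inner_diff_right)
  \<comment> \<open>\<open>G V - ys\<close> lies in \<open>S\<close>, to which
    \<open>ys - stack x\<close> is orthogonal. The squared residuals against the data and against
    the means thus differ by a constant independent of \<open>V\<close>.\<close>
  have pythagoras: "(norm (G V - stack x))\<^sup>2 = (norm (G V - ys))\<^sup>2 + (norm (ys - stack x))\<^sup>2" for V
  proof -
    have "G V - stack x = (G V - ys) + (ys - stack x)" by simp
    then show ?thesis
      using norm_add_Pythagorean[of "G V - ys" "ys - stack x"] orth(1)[OF subspace_diff[OF subS GS ysS]]
      by (simp add: orthogonal_def)
  qed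
  have res0: "norm (G W\<^sub>0 - ys) \<le> Rhat\<^sub>0"
  proof -
    have "norm (G W\<^sub>0 - ys) \<le> norm (G W\<^sub>0 - stack x)"
      by (rule power2_le_imp_le) (simp_all add: pythagoras)
    then show ?thesis using R0 by linarith
  qed

  \<comment> \<open>The reference path\<close>
  define U where "U = rec_nat W\<^sub>0 (\<lambda>_ V. V - \<eta> *\<^sub>R adjoint (G' V) (G V - stack x))"
  have U: "U 0 = W\<^sub>0" "\<And>t. U (Suc t) = U t - \<eta> *\<^sub>R adjoint (G' (U t)) (G (U t) - stack x)"
    by (simp_all add: U_def)
  \<comment> \<open>The raw data play \<open>y'\<close> and the cluster means play \<open>y\<close>;
    with \<open>r = Rhat\<^sub>0\<close> the required radius is that of \<open>h5\<close>.\<close>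
  note conv = lipschitz_jacobian.gradient_descent_convergence[OF lip, where S = S and \<alpha> = \<alpha> and \<eta> = \<eta>
      and r = "Rhat\<^sub>0" and y = ys and y' = "stack x" and u = U,
      OF subS G'S lower \<alpha> L_pos h7(1) \<eta> subspace_diff[OF subS GS ysS] res0 orth(2) h5 U]
  have U_res: "norm (G (U t) - stack x) \<le> Rhat\<^sub>0" for t
  proof -
    have "0 \<le> 1 - \<eta> * \<alpha>\<^sup>2 / 2" "1 - \<eta> * \<alpha>\<^sup>2 / 2 \<le> 1"
      using step_size_mult_le(2)[OF \<alpha> h7(1) \<eta>(1)] h7(1) by auto
    then have "(1 - \<eta> * \<alpha>\<^sup>2 / 2) ^ t * norm (G W\<^sub>0 - ys) \<le> 1 * norm (G W\<^sub>0 - ys)"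
      by (intro mult_right_mono power_le_one) auto
    then have "norm (G (U t) - ys) \<le> norm (G W\<^sub>0 - ys)" using conv(3)[of t] by simp
    \<comment> \<open>The residual against the raw data keeps its orthogonal part, so it need not
      decay, but it never exceeds its initial value.\<close>
    then have "(norm (G (U t) - stack x))\<^sup>2 \<le> (norm (G W\<^sub>0 - stack x))\<^sup>2"
      unfolding pythagoras by (intro add_right_mono power_mono) simp_all
    then have "norm (G (U t) - stack x) \<le> norm (G W\<^sub>0 - stack x)"
      by (rule power2_le_imp_le) simp
    then show ?thesis using R0 by linarith
  qed
  have U_T: "norm (G (U T) - ys) \<le> \<nu>"
  proof -
    have a: "\<eta> * \<alpha>\<^sup>2 / 2 \<le> 1" "0 < \<eta> * \<alpha>\<^sup>2"
      using step_size_mult_le(2)[OF \<alpha> h7(1) \<eta>(1)] h7(1) \<alpha> by auto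
    \<comment> \<open>The ceiling and \<open>log_plus\<close> only enlarge the step count, so
      \<open>T\<close> still dominates the plain logarithm.\<close>
    have "2 / (\<eta> * \<alpha>\<^sup>2) * log_plus (Rhat\<^sub>0 / \<nu>) \<le> real T"
      using h8(1) T_star[OF \<nu>] by (simp add: \<nu>_def ceiling_le_iff)
    then have "log_plus (Rhat\<^sub>0 / \<nu>) \<le> \<eta> * \<alpha>\<^sup>2 / 2 * real T"
      using a(2) by (simp add: field_simps)
    then have "ln (Rhat\<^sub>0 / \<nu>) \<le> \<eta> * \<alpha>\<^sup>2 / 2 * real T" by (simp add: log_plus_def)
    from geometric_decay_le[OF a(1) Rhat_pos \<nu> this]
    have "(1 - \<eta> * \<alpha>\<^sup>2 / 2) ^ T * Rhat\<^sub>0 \<le> \<nu>" .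
    moreover have "(1 - \<eta> * \<alpha>\<^sup>2 / 2) ^ T * norm (G W\<^sub>0 - ys) \<le> (1 - \<eta> * \<alpha>\<^sup>2 / 2) ^ T * Rhat\<^sub>0"
      using a res0 by (intro mult_left_mono) auto
    ultimately show ?thesis using conv(3)[of T] by linarith
  qed

  \<comment> \<open>Replacing clean inputs by noisy ones\<close>
  have B: "0 \<le> B\<^sub>1" "0 \<le> B\<^sub>2" using h6(3,4)[of 0] by simp_all
  have R_W0: "0 \<le> R\<^sub>W" unfolding R_W using R_loc_pos by simp
  have norm_V: "norm V \<le> R\<^sub>W" if "V \<in> cball W\<^sub>0 R\<^sub>l\<^sub>o\<^sub>c" for V
  proof -
    have "norm V \<le> norm W\<^sub>0 + norm (V - W\<^sub>0)" by norm
    then show ?thesis using that unfolding R_W by (simp add: dist_norm norm_minus_commute)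
  qed
  have R_mu_ge: "norm (\<mu> k) \<le> R\<^sub>\<mu>" for k unfolding R_mu by simp
  then have R_mu0: "0 \<le> R\<^sub>\<mu>" using norm_ge_zero order_trans by blast
  have dev: "norm (x i - x' i) \<le> \<epsilon>\<^sub>c + \<epsilon>\<^sub>o" for i
    using norm_triangle_mono[OF h1(2)[of i] noise_bound[of i]] h3(1) by (simp add: samples split: if_splits)
  have eps0: "0 \<le> \<epsilon>\<^sub>c + \<epsilon>\<^sub>o" using h1(1) h3(1) by simp
  have Delta_f0: "0 \<le> \<Delta>\<^sub>f" unfolding Delta_f using B R_W0 eps0 opnorm_nonneg by (intro mult_nonneg_nonneg)
  have Delta_J0: "0 \<le> \<Delta>\<^sub>J" unfolding Delta_J using B R_W0 R_mu0 h1(1) h3(1) n0 opnorm_nonneg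
    by (intro mult_nonneg_nonneg add_nonneg_nonneg) simp_all
  have net_dev: "norm (net A \<phi> V (x i) - net A \<phi> V (x' i)) \<le> \<Delta>\<^sub>f" if "V \<in> cball W\<^sub>0 R\<^sub>l\<^sub>o\<^sub>c" for V i
  proof -
    have "norm (net A \<phi> V (x i) - net A \<phi> V (x' i)) \<le> opnorm A * B\<^sub>1 * norm V * norm (x i - x' i)"
      by (rule norm_net_diff_le[OF h6(1,3)])
    also have "\<dots> \<le> \<Delta>\<^sub>f"
      unfolding Delta_f using norm_V[OF that] dev B R_W0 eps0 opnorm_nonneg
      by (intro mult_mono mult_left_mono) auto
    finally show ?thesis .
  qed
  have deriv_dev: "norm (net_deriv A \<phi> (x i) V v - net_deriv A \<phi> (x' i) V v)
      \<le> opnorm A * (B\<^sub>1 + B\<^sub>2 * R\<^sub>W * R\<^sub>\<mu>) * (\<epsilon>\<^sub>c + \<epsilon>\<^sub>o) * norm v" if "V \<in> cball W\<^sub>0 R\<^sub>l\<^sub>o\<^sub>c" for V v i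
  proof -
    \<comment> \<open>The clean input is put in the place of \<open>y\<close>, whose norm is then at
      most \<open>R\<^sub>\<mu>\<close>.\<close>
    have "norm (net_deriv A \<phi> (x i) V v - net_deriv A \<phi> (x' i) V v)
        \<le> opnorm A * (B\<^sub>1 + B\<^sub>2 * norm V * norm (x' i)) * norm (x i - x' i) * norm v"
      by (rule norm_net_deriv_diff_le[OF h6(2,3,4)])
    also have "\<dots> \<le> opnorm A * (B\<^sub>1 + B\<^sub>2 * R\<^sub>W * R\<^sub>\<mu>) * (\<epsilon>\<^sub>c + \<epsilon>\<^sub>o) * norm v"
      using norm_V[OF that] dev B R_W0 R_mu0 eps0 opnorm_nonneg[of A] R_mu_ge
      by (intro mult_right_mono mult_mono mult_left_mono add_left_mono) (auto simp: clean)
    finally show ?thesis .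
  qed
  have H_G: "norm (H V - G V) \<le> sqrt n * \<Delta>\<^sub>f" if "V \<in> cball W\<^sub>0 R\<^sub>l\<^sub>o\<^sub>c" for V
    unfolding H_def G_def net_stack_def stack_diff[symmetric] n
    by (rule norm_stack_le[OF net_dev[OF that]])
  have H'_G': "norm (H' V v - G' V v) \<le> \<Delta>\<^sub>J * norm v" if "V \<in> cball W\<^sub>0 R\<^sub>l\<^sub>o\<^sub>c" for V v
  proof -
    have "norm (H' V v - G' V v)
        \<le> sqrt n * (opnorm A * (B\<^sub>1 + B\<^sub>2 * R\<^sub>W * R\<^sub>\<mu>) * (\<epsilon>\<^sub>c + \<epsilon>\<^sub>o) * norm v)"
      unfolding H'_def G'_def net_stack_deriv_def stack_diff[symmetric] n
      by (rule norm_stack_le[OF deriv_dev[OF that]])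
    then show ?thesis by (simp add: Delta_J mult.assoc)
  qed
  have W_step: "W (Suc t) = W t - \<eta> *\<^sub>R adjoint (H' (W t)) (H (W t) - stack x)" for t
  proof -
    have "vec_mat (W (Suc t)) = vec_mat (W t - \<eta> *\<^sub>R adjoint (H' (W t)) (H (W t) - stack x))"
      by (simp only: gd_step J net_jacobian_transpose_mult[OF h6(1)] H_def H'_def
          linear_diff[OF linear_vec_mat] linear_scale[OF linear_vec_mat])
    then show ?thesis by (metis unvec_mat_vec_mat)
  qed
  have W_T: "norm (W T - U T) \<le> \<Delta>_path T" "W T \<in> cball W\<^sub>0 R\<^sub>l\<^sub>o\<^sub>c"
  proof -
    have "norm (W T - U T) \<le> \<eta> * \<gamma> * real T * exp (\<eta> * \<kappa> * real T) \<and> W T \<in> cball W\<^sub>0 R\<^sub>l\<^sub>o\<^sub>c"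
    \<comment> \<open>\<open>\<Delta>\<^sub>f\<close> controls a single sample; stacking brings in
      \<open>sqrt n\<close>, which reproduces the term
      \<open>\<beta>\<^sub>X * sqrt n * \<Delta>\<^sub>f\<close> of \<open>\<gamma>\<close>. The
      choice of \<open>R'\<close> is the radius of the reference path.\<close>
    proof (rule lipschitz_jacobian.perturbed_gradient_descent[OF lip, where H = H and H' = H'
          and e = "sqrt n * \<Delta>\<^sub>f" and e' = "\<Delta>\<^sub>J" and r = "Rhat\<^sub>0" and u = U and w = W and y = "stack x"
          and R' = "2 * \<beta> / \<alpha>\<^sup>2 * Rhat\<^sub>0" and T = T and t = T])
      show "linear (H' V)" for V unfolding H'_def by (rule linear_net_stack_deriv[OF h6(1)])
      show "\<eta> * \<gamma> * real T * exp (\<eta> * \<kappa> * real T) \<le> R\<^sub>l\<^sub>o\<^sub>c - 2 * \<beta> / \<alpha>\<^sup>2 * Rhat\<^sub>0"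
        using h8(2) unfolding Delta_path .
    qed (use H_G H'_G' \<beta>0 L_pos Delta_f0 Delta_J0 n0 Rhat_pos h7(1) U gd_init W_step conv U_res
        in \<open>auto simp: kappa gamma beta_X\<close>)
    then show "norm (W T - U T) \<le> \<Delta>_path T" "W T \<in> cball W\<^sub>0 R\<^sub>l\<^sub>o\<^sub>c"
      unfolding Delta_path by auto
  qed

  \<comment> \<open>Reconstruction errors\<close>
  have key: "norm (net A \<phi> (W T) (x i) - \<mu> (g i)) \<le> \<zeta> T + 2 * \<nu>" for i
  proof -
    have "norm (net A \<phi> (W T) (x' i) - net A \<phi> (U T) (x' i)) \<le> norm (G (W T) - G (U T))"
      using norm_le_norm_stack[of "\<lambda>i. net A \<phi> (W T) (x' i) - net A \<phi> (U T) (x' i)" i]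
      by (simp add: G_def net_stack_def stack_diff)
    also have "\<dots> \<le> \<beta> * norm (W T - U T)"
      by (rule lipschitz_jacobian.lipschitz_map[OF lip W_T(2) conv(2)])
    also have "\<dots> \<le> \<beta> * \<Delta>_path T" using W_T(1) \<beta>0 by (rule mult_left_mono)
    finally have b: "norm (net A \<phi> (W T) (x' i) - net A \<phi> (U T) (x' i)) \<le> \<beta> * \<Delta>_path T" .
    have "norm (net A \<phi> (U T) (x' i) - cluster_mean g x (g i)) \<le> norm (G (U T) - ys)"
      using norm_le_norm_stack[of "\<lambda>i. net A \<phi> (U T) (x' i) - cluster_mean g x (g i)" i]
      by (simp add: G_def net_stack_def ys_def stack_diff)
    then have c: "norm (net A \<phi> (U T) (x' i) - cluster_mean g x (g i)) \<le> \<nu>" using U_T by linarith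
    \<comment> \<open>Four links join the output to the center: noisy to clean input
      (\<open>\<Delta>\<^sub>f\<close>), trained to reference weights
      (\<open>\<beta> * \<Delta>_path T\<close>), reference output to cluster mean
      (\<open>\<nu>\<close>), and mean to center (\<open>\<nu>\<close>).\<close>
    have "norm (net A \<phi> (W T) (x i) - \<mu> (g i)) \<le> norm (net A \<phi> (W T) (x i) - net A \<phi> (W T) (x' i))
        + norm (net A \<phi> (W T) (x' i) - net A \<phi> (U T) (x' i))
        + norm (net A \<phi> (U T) (x' i) - cluster_mean g x (g i)) + norm (cluster_mean g x (g i) - \<mu> (g i))"
      by norm
    then show ?thesis using net_dev[OF W_T(2), of i] b c mean_bound[of "g i"] unfolding zeta by linarith
  qed
  have two_nu: "2 * \<nu> = 2 * \<epsilon>\<^sub>c + 2 * \<rho> * \<epsilon>\<^sub>o" by (simp add: \<nu>_def)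
  have inlier: "norm (net A \<phi> (W T) (x i) - x i) \<le> \<zeta> T + 3 * \<epsilon>\<^sub>c + 2 * \<rho> * \<epsilon>\<^sub>o" if "i \<notin> \<O>" for i
  proof -
    have "x i = \<mu> (g i) + \<xi> i" using that by (simp add: samples clean outliers)
    then have eq: "net A \<phi> (W T) (x i) - x i = (net A \<phi> (W T) (x i) - \<mu> (g i)) - \<xi> i"
      by (simp only: diff_diff_add)
    have "norm (net A \<phi> (W T) (x i) - x i) \<le> norm (net A \<phi> (W T) (x i) - \<mu> (g i)) + norm (\<xi> i)"
      unfolding eq by (rule norm_triangle_ineq4)
    then show ?thesis using key[of i] h1(2)[of i] two_nu by linarith
  qed
  have outlier: "norm (out i) - \<zeta> T - 3 * \<epsilon>\<^sub>c - 2 * \<rho> * \<epsilon>\<^sub>o \<le> norm (net A \<phi> (W T) (x i) - x i)" for i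
  proof -
    \<comment> \<open>Solving the decomposition of \<open>x i\<close> for \<open>out i\<close> turns
      the upper bound \<open>key\<close> into a lower bound on the error.\<close>
    have eq: "out i = (net A \<phi> (W T) (x i) - \<mu> (g i)) - \<xi> i - (net A \<phi> (W T) (x i) - x i)"
      by (simp add: samples[of i] clean)
    have "norm (out i) \<le> norm (net A \<phi> (W T) (x i) - \<mu> (g i)) + norm (\<xi> i)
        + norm (net A \<phi> (W T) (x i) - x i)"
      unfolding eq by norm
    then show ?thesis using key[of i] h1(2)[of i] two_nu by linarith
  qed
  have "norm (net A \<phi> (W T) (x j) - x j) < norm (net A \<phi> (W T) (x i) - x i)"
    if large: "\<delta> + ereal (2 * \<epsilon>\<^sub>c) < ereal (norm (out i))" and "j \<notin> \<O>" for i j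
  proof -
    \<comment> \<open>The comparison stays in the extended reals: with a single center
      \<open>\<delta>\<close> is infinite, and then \<open>large\<close> cannot hold.\<close>
    have "ereal (2 * \<zeta> T + 4 * (\<epsilon>\<^sub>c + \<rho> * \<epsilon>\<^sub>o)) + ereal (2 * \<epsilon>\<^sub>c) \<le> \<delta> + ereal (2 * \<epsilon>\<^sub>c)"
      using h8(3) by (intro add_right_mono) simp
    then have "ereal (2 * \<zeta> T + 4 * (\<epsilon>\<^sub>c + \<rho> * \<epsilon>\<^sub>o)) + ereal (2 * \<epsilon>\<^sub>c) < ereal (norm (out i))"
      using large by (rule le_less_trans)
    then have "2 * \<zeta> T + 4 * \<nu> + 2 * \<epsilon>\<^sub>c < norm (out i)" by (simp add: \<nu>_def)
    \<comment> \<open>The threshold is twice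
      \<open>\<zeta> T + 2 * \<nu> + \<epsilon>\<^sub>c\<close>: once for the error of the inlier
      \<open>j\<close>, once for what the error at \<open>i\<close> can fall short of
      \<open>norm (out i)\<close>.\<close>
    then show ?thesis
      using inlier[OF \<open>j \<notin> \<O>\<close>] outlier[of i] \<nu> h1(1) two_nu by linarith
  qed
  then show ?thesis using inlier outlier by blast
qed

end
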